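(* Let $\mathbb{S}^3$ be the unit sphere of $\mathbb{R}^4=\mathbb{C}^2$ and $\varpi$ the Kähler form. The Cauchy-Riemann inequality $$-\int_{\mathbb{S}^3}\varpi(\nabla f,\nabla h)\,dM\ \le\ \frac23\sqrt{\int_{\mathbb{S}^3}\|\nabla f\|^2dM}\ \sqrt{\int_{\mathbb{S}^3}\|\nabla h\|^2dM}$$ holds for any smooth functions $f$ and $h$ of $\mathbb{S}^3$, with equality if and only if $f,h\in E_{\lambda_1}$, with $f=\sum_{i}\mu_i\phi_i$ and $h=\sum_{i}\sigma_i\phi_i$, where $\sigma_2=-\mu_1$, $\sigma_1=\mu_2$, $\sigma_4=-\mu_3$, $\sigma_3=\mu_4$.
   Context: $\phi_1,\ldots,\phi_4$ are the restrictions to $\mathbb{S}^3$ of the coordinate functions $x_1,\ldots,x_4$ of $\mathbb{R}^4$, and $\mu_i,\sigma_i$ ($1\le i\le 4$) are real constants; $\nabla f$ is the gradient on $\mathbb{S}^3$, regarded as a tangent vector in $\mathbb{R}^4$; $\varpi=dx^1\wedge dx^2+dx^3\wedge dx^4$ on $\mathbb{R}^4$ (the restriction to $\mathbb{R}^4\times\{0\}$ of the Kähler form $dx^{12}+dx^{34}+dx^{56}$ of $\mathbb{C}^3=\mathbb{R}^6$, where $dx^{ij}=dx^i\wedge dx^j$). $E_{\lambda_1}$ is the eigenspace of the Laplacian of $\mathbb{S}^3$ for the eigenvalue $\lambda_1=3$, i.e. the span of $\phi_1,\ldots,\phi_4$.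
   Formalization: "Only if" fails as printed (f=φ_1, h=-2φ_2 gives equality). The iff is stated for f,h of mean zero with equal Dirichlet energy; for all smooth f,h: equality iff f or h is constant, or the printed form holds after adding constants to f,h and scaling h by a positive constant. *)

theory Defs
  imports "HOL-Analysis.Analysis"
begin

text \<open>Functions on the sphere are represented by functions on the ambient space; every notion below
  depends only on their values on \<^term>\<open>sphere 0 1\<close>.\<close>

fun Ck_on :: "nat \<Rightarrow> 'a::euclidean_space set \<Rightarrow> ('a \<Rightarrow> real) \<Rightarrow> bool" where
  "Ck_on 0 U F \<longleftrightarrow> continuous_on U F"
| "Ck_on (Suc k) U F \<longleftrightarrow> (\<forall>x\<in>U. F differentiable (at x)) \<and>
     (\<forall>b\<in>Basis. Ck_on k U (\<lambda>x. frechet_derivative F (at x) b))"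

text \<open>A function on a submanifold is smooth iff it locally extends to a smooth function on an
  open subset of the ambient space.\<close>

definition smooth_on_sphere :: "('a::euclidean_space \<Rightarrow> real) \<Rightarrow> bool" where
  "smooth_on_sphere f \<longleftrightarrow>
     (\<forall>p\<in>sphere 0 1. \<exists>U F. open U \<and> p \<in> U \<and> (\<forall>k. Ck_on k U F) \<and>
        (\<forall>x\<in>U \<inter> sphere 0 1. F x = f x))"

text \<open>The gradient at \<open>p\<close>: the tangent vector \<open>v\<close> (that is, \<open>v \<bullet> p = 0\<close>) that represents the
  differential of \<open>f\<close>. A derivative within the sphere is determined on tangent vectors only;
  the tangency condition makes \<open>v\<close> unique.\<close>

definition sphere_grad :: "('a::euclidean_space \<Rightarrow> real) \<Rightarrow> 'a \<Rightarrow> 'a" where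
  "sphere_grad f p =
     (THE v. v \<bullet> p = 0 \<and> (f has_derivative (\<lambda>w. v \<bullet> w)) (at p within sphere 0 1))"

text \<open>The Riemannian volume measure of the unit sphere, by polar coordinates:
  the volume of \<open>A\<close> is the dimension of the ambient space times the Lebesgue measure of the cone
  \<open>{t *\<^sub>R x | 0 < t < 1, x \<in> A}\<close>.\<close>

definition sphere_measure :: "'a::euclidean_space measure" where
  "sphere_measure =
     scale_measure (of_nat DIM('a))
       (distr (restrict_space lborel (ball 0 1 - {0})) (restrict_space borel (sphere 0 1)) sgn)"

definition kaehler_form :: "real^4 \<Rightarrow> real^4 \<Rightarrow> real" where
  "kaehler_form u v = (u$1 * v$2 - u$2 * v$1) + (u$3 * v$4 - u$4 * v$3)"

definition dirichlet_energy :: "(real^4 \<Rightarrow> real) \<Rightarrow> real" where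
  "dirichlet_energy f = (LINT x|sphere_measure. (norm (sphere_grad f x))\<^sup>2)"

text \<open>The eigenspace of the Laplacian of the 3-sphere for the eigenvalue 3: the span of the
  coordinate functions.\<close>

definition first_eigenspace :: "(real^4 \<Rightarrow> real) set" where
  "first_eigenspace = {f. \<exists>\<mu>::4 \<Rightarrow> real. \<forall>x\<in>sphere 0 1. f x = (\<Sum>i\<in>UNIV. \<mu> i * x$i)}"

definition extremal_pair :: "(real^4 \<Rightarrow> real) \<Rightarrow> (real^4 \<Rightarrow> real) \<Rightarrow> bool" where
  "extremal_pair f h \<longleftrightarrow> f \<in> first_eigenspace \<and> h \<in> first_eigenspace \<and>
     (\<exists>\<mu> \<sigma> :: 4 \<Rightarrow> real.
        (\<forall>x\<in>sphere 0 1. f x = (\<Sum>i\<in>UNIV. \<mu> i * x$i)) \<and>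
        (\<forall>x\<in>sphere 0 1. h x = (\<Sum>i\<in>UNIV. \<sigma> i * x$i)) \<and>
        \<sigma> 2 = - \<mu> 1 \<and> \<sigma> 1 = \<mu> 2 \<and> \<sigma> 4 = - \<mu> 3 \<and> \<sigma> 3 = \<mu> 4)"

text \<open>Both sides of the Cauchy-Riemann inequality are unchanged when constants are added to \<open>f\<close>
  and \<open>h\<close>, and scale alike when \<open>f\<close> or \<open>h\<close> is multiplied by a positive constant. Hence equality
  characterises \<^const>\<open>extremal_pair\<close> exactly for pairs normalised by mean value zero and equal
  Dirichlet energy, and characterises it up to these operations in general.\<close>

definition normalised_pair :: "(real^4 \<Rightarrow> real) \<Rightarrow> (real^4 \<Rightarrow> real) \<Rightarrow> bool" where
  "normalised_pair f h \<longleftrightarrow>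
     (LINT x|sphere_measure. f x) = 0 \<and> (LINT x|sphere_measure. h x) = 0 \<and>
     dirichlet_energy f = dirichlet_energy h"

end

theory Submission
  imports Defs "HOL-Complex_Analysis.Cauchy_Integral_Formula"
begin

text \<open>Write \<open>X\<^sub>i\<close> for differentiation along the flow of \<open>x \<mapsto> J\<^sub>i x\<close>, where \<open>J\<^sub>1, J\<^sub>2, J\<^sub>3\<close> are the
  quaternionic complex structures of \<open>\<real>\<^sup>4\<close> and \<open>J\<^sub>1\<close> is multiplication by \<open>\<i>\<close>. The vectors
  \<open>J\<^sub>1 x, J\<^sub>2 x, J\<^sub>3 x\<close> are an orthonormal frame of the tangent space at \<open>x\<close>, so the energy density of
  \<open>f\<close> is \<open>\<Sum> (X\<^sub>i f)\<^sup>2\<close> and, since \<open>J\<^sub>1\<close> turns \<open>J\<^sub>2 x\<close> into \<open>J\<^sub>3 x\<close> and \<open>J\<^sub>1 x\<close> into the normal \<open>- x\<close>, the form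
  \<open>\<varpi>(\<nabla>f, \<nabla>h)\<close> is \<open>X\<^sub>2 f X\<^sub>3 h - X\<^sub>3 f X\<^sub>2 h\<close>. The flows are isometries, so every \<open>X\<^sub>i\<close> is
  skew-adjoint, and \<open>[X\<^sub>2, X\<^sub>3] = - 2 X\<^sub>1\<close> gives \<open>K = \<integral> \<varpi>(\<nabla>f, \<nabla>h) = \<integral> (f X\<^sub>1 h - h X\<^sub>1 f)\<close>
  (lemma \<open>kaehler_integral\<close>).

  Using the first expression for \<open>2 K\<close> and the second one for the remaining \<open>K\<close> splits
  \<open>E f + E h + 3 K\<close> (where \<open>E\<close> is the Dirichlet energy) into two defects (lemma \<open>defect_identity\<close>):
  \<open>\<integral> (X\<^sub>2 f + X\<^sub>3 h)\<^sup>2 + (X\<^sub>3 f - X\<^sub>2 h)\<^sup>2\<close>, which is a square and vanishes iff \<open>f - \<i> h\<close> satisfies the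
  tangential Cauchy-Riemann equation, and \<open>\<integral> (X\<^sub>1 f)\<^sup>2 + (X\<^sub>1 h)\<^sup>2 + f X\<^sub>1 h - h X\<^sub>1 f\<close>. The second one
  is nonnegative on each Hopf fibre separately: in terms of the Fourier modes of \<open>f - \<i> h\<close>
  along the circle it is \<open>m\<^sup>2 - m \<ge> 0\<close>, with equality exactly for the modes \<open>0\<close> and \<open>1\<close>. This is proved
  without Fourier series, from Wirtinger's inequality with Dirichlet boundary values
  (lemma \<open>loop_inequality\<close>).

  If both defects vanish, the even and the odd part of \<open>f - \<i> h\<close> are homogeneous of weight \<open>0\<close> and \<open>1\<close>
  along the fibres and satisfy the Cauchy-Riemann equation, so their homogeneous extensions
  are holomorphic away from the origin of \<open>\<complex>\<^sup>2\<close>. On an affine complex line they are entire functions of polynomial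
  growth, and Liouville's theorem makes them complex polynomials of degree \<open>0\<close> and \<open>1\<close> (lemma
  \<open>weighted_CR_imp_polynomial\<close>); complex linear \<open>f - \<i> h\<close> is precisely the extremal case.

  Hence \<open>E f + E h + 3 K \<ge> 0\<close>, with equality iff the pair is extremal up to additive constants
  (lemma \<open>energy_sum_inequality\<close>). For nonconstant functions, applying this to \<open>f\<close> and \<open>c h\<close>
  with the \<open>c > 0\<close> that equalises the two energies turns the sum of the energies into the product of their square roots.\<close>

section \<open>Wirtinger's inequality on the circle\<close>

text \<open>The elementary case of l'Hopital's rule that gives the limits of \<open>k / sin\<close> at the end points below.\<close>

lemma quotient_tendsto_of_common_zero:
  fixes f g :: "real \<Rightarrow> real"
  assumes "(f has_real_derivative d) (at c)" "f c = 0"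
    and "(g has_real_derivative e) (at c)" "g c = 0" "e \<noteq> 0"
  shows "((\<lambda>t. f t / g t) \<longlongrightarrow> d / e) (at c)"
proof -
  have "((\<lambda>t. ((f t - f c) / (t - c)) / ((g t - g c) / (t - c))) \<longlongrightarrow> d / e) (at c)"
    using assms unfolding has_field_derivative_iff by (intro tendsto_divide) auto
  then show ?thesis
    by (rule Lim_transform_eventually) (use assms in \<open>auto simp: eventually_at_filter\<close>)
qed

text \<open>With \<open>s = k' - k cot((t - a)/2) / 2\<close> one has
  \<open>k'\<^sup>2 - k\<^sup>2/4 - s\<^sup>2 = (k\<^sup>2 cot((t - a)/2) / 2)'\<close>, and the boundary terms vanish because \<open>k\<close> does.
  In the case of equality \<open>s = 0\<close>, which says that \<open>k / sin((t - a)/2)\<close> is constant.\<close>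

lemma dirichlet_wirtinger:
  fixes k k' :: "real \<Rightarrow> real"
  assumes k: "\<And>t. (k has_real_derivative k' t) (at t)" and k': "continuous_on UNIV k'"
    and zero: "k a = 0" "k (a + 2 * pi) = 0"
  shows "0 \<le> integral {a..a + 2 * pi} (\<lambda>t. (k' t)\<^sup>2 - (k t)\<^sup>2 / 4)"
    and "integral {a..a + 2 * pi} (\<lambda>t. (k' t)\<^sup>2 - (k t)\<^sup>2 / 4) = 0 \<Longrightarrow>
      \<exists>c. \<forall>t\<in>{a..a + 2 * pi}. k t = c * sin ((t - a) / 2)"
proof -
  define b where "b = a + 2 * pi"
  \<comment> \<open>The continuous extension of \<open>k / sin((t - a)/2)\<close> to the closed interval.\<close>
  define Q where "Q t = (if t = a then 2 * k' a else if t = b then - 2 * k' b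
    else k t / sin ((t - a) / 2))" for t
  define s where "s t = k' t - Q t * cos ((t - a) / 2) / 2" for t
  have ab: "a < b" by (simp add: b_def)
  have kcont: "continuous_on UNIV k"
    using k by (intro DERIV_continuous_on[of _ _ k']) (auto intro: has_field_derivative_at_within)
  have sin_pos: "sin ((t - a) / 2) > 0" if "a < t" "t < b" for t
    using that by (intro sin_gt_zero) (auto simp: b_def)
  have dsin: "((\<lambda>t. sin ((t - a) / 2)) has_real_derivative cos ((t - a) / 2) / 2) (at t)" for t
    by (auto intro!: derivative_eq_intros)
  have Qint: "(Q has_real_derivative
      (k' t * sin ((t - a) / 2) - k t * (cos ((t - a) / 2) / 2)) / (sin ((t - a) / 2))\<^sup>2) (at t)"
    if "a < t" "t < b" for t
  proof (rule has_field_derivative_transform_within_open[of "\<lambda>t. k t / sin ((t - a) / 2)" _ _ "{a<..<b}"])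
    show "((\<lambda>t. k t / sin ((t - a) / 2)) has_real_derivative
      (k' t * sin ((t - a) / 2) - k t * (cos ((t - a) / 2) / 2)) / (sin ((t - a) / 2))\<^sup>2) (at t)"
      using DERIV_divide[OF k dsin, of t] sin_pos[OF that] by (simp add: power2_eq_square)
  qed (use that in \<open>auto simp: Q_def\<close>)
  have Qcont: "continuous_on {a..b} Q"
  proof (rule continuous_at_imp_continuous_on, intro ballI)
    fix t assume t: "t \<in> {a..b}"
    have end1: "(Q \<longlongrightarrow> Q a) (at a)"
    proof -
      have "((\<lambda>t. k t / sin ((t - a) / 2)) \<longlongrightarrow> k' a / (cos ((a - a) / 2) / 2)) (at a)"
        by (rule quotient_tendsto_of_common_zero[OF k _ dsin]) (use zero in auto)
      then have "((\<lambda>t. k t / sin ((t - a) / 2)) \<longlongrightarrow> Q a) (at a)" by (simp add: Q_def mult.commute)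
      then show ?thesis
        by (rule Lim_transform_within_open[of _ _ _ _ "{..<b}"]) (use ab in \<open>auto simp: Q_def\<close>)
    qed
    have end2: "(Q \<longlongrightarrow> Q b) (at b)"
    proof -
      have "((\<lambda>t. k t / sin ((t - a) / 2)) \<longlongrightarrow> k' b / (cos ((b - a) / 2) / 2)) (at b)"
        by (rule quotient_tendsto_of_common_zero[OF k _ dsin]) (use zero in \<open>auto simp: b_def\<close>)
      then have "((\<lambda>t. k t / sin ((t - a) / 2)) \<longlongrightarrow> Q b) (at b)" using ab by (simp add: Q_def b_def mult.commute)
      then show ?thesis
        by (rule Lim_transform_within_open[of _ _ _ _ "{a<..}"]) (use ab in \<open>auto simp: Q_def\<close>)
    qed
    show "isCont Q t"
      using t end1 end2 DERIV_isCont[OF Qint[of t]] by (auto simp: continuous_at less_le)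
  qed
  have scont: "continuous_on {a..b} s"
    unfolding s_def by (intro continuous_intros Qcont continuous_on_subset[OF k'] subset_UNIV) auto
  define F where "F t = k t * Q t * cos ((t - a) / 2) / 2" for t
  have "((\<lambda>t. ((k' t)\<^sup>2 - (k t)\<^sup>2 / 4) - (s t)\<^sup>2) has_integral F b - F a) {a..b}"
  proof (rule fundamental_theorem_of_calculus_interior)
    show "continuous_on {a..b} F"
      unfolding F_def by (intro continuous_intros Qcont continuous_on_subset[OF kcont] subset_UNIV) auto
    fix t assume "t \<in> {a<..<b}"
    then have t: "a < t" "t < b" by auto
    define u v where "u = sin ((t - a) / 2)" and "v = cos ((t - a) / 2)"
    have u: "u > 0" using sin_pos[OF t] by (simp add: u_def)
    have uv: "v\<^sup>2 = 1 - u\<^sup>2" by (simp add: u_def v_def cos_squared_eq)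
    have Qt: "Q t = k t / u" using t by (simp add: Q_def u_def)
    have dcos: "((\<lambda>t. cos ((t - a) / 2)) has_real_derivative - sin ((t - a) / 2) / 2) (at t)"
      by (auto intro!: derivative_eq_intros)
    have "(F has_real_derivative ((k' t * Q t + (k' t * u - k t * (v / 2)) / u\<^sup>2 * k t) * v
        + (- u / 2) * (k t * Q t)) / 2) (at t)"
      unfolding F_def
      using DERIV_cdivide[OF DERIV_mult[OF DERIV_mult[OF k Qint[OF t]] dcos], of 2]
      by (simp add: u_def v_def)
    moreover have "((k' t * Q t + (k' t * u - k t * (v / 2)) / u\<^sup>2 * k t) * v
        + (- u / 2) * (k t * Q t)) / 2 = ((k' t)\<^sup>2 - (k t)\<^sup>2 / 4) - (s t)\<^sup>2"
    proof -
      have "u\<^sup>2 * (((k' t * Q t + (k' t * u - k t * (v / 2)) / u\<^sup>2 * k t) * v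
        + (- u / 2) * (k t * Q t)) / 2) = k t * k' t * u * v - (k t)\<^sup>2 * v\<^sup>2 / 4 - (k t)\<^sup>2 * u\<^sup>2 / 4"
        using u by (simp add: Qt field_simps power2_eq_square)
      moreover have "u\<^sup>2 * (((k' t)\<^sup>2 - (k t)\<^sup>2 / 4) - (s t)\<^sup>2)
          = k t * k' t * u * v - (k t)\<^sup>2 * v\<^sup>2 / 4 - (k t)\<^sup>2 * u\<^sup>2 / 4"
        using u unfolding s_def v_def[symmetric] by (simp add: Qt field_simps power2_eq_square)
      ultimately show ?thesis using u by (metis mult_cancel_left less_irrefl zero_less_power)
    qed
    ultimately show "(F has_vector_derivative ((k' t)\<^sup>2 - (k t)\<^sup>2 / 4) - (s t)\<^sup>2) (at t)"
      unfolding has_real_derivative_iff_has_vector_derivative by metis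
  qed (use ab in simp)
  moreover have "F b - F a = 0" using zero by (simp add: F_def b_def)
  ultimately have diff: "((\<lambda>t. ((k' t)\<^sup>2 - (k t)\<^sup>2 / 4) - (s t)\<^sup>2) has_integral 0) {a..b}" by simp
  have "(\<lambda>t. (k' t)\<^sup>2 - (k t)\<^sup>2 / 4) integrable_on {a..b}"
    by (intro integrable_continuous_real continuous_intros continuous_on_subset[OF k'] continuous_on_subset[OF kcont]) auto
  from has_integral_diff[OF integrable_integral[OF this] diff]
  have s2: "((\<lambda>t. (s t)\<^sup>2) has_integral integral {a..b} (\<lambda>t. (k' t)\<^sup>2 - (k t)\<^sup>2 / 4)) {a..b}" by simp
  show "0 \<le> integral {a..a + 2 * pi} (\<lambda>t. (k' t)\<^sup>2 - (k t)\<^sup>2 / 4)"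
    unfolding b_def[symmetric] by (rule has_integral_nonneg[OF s2]) simp
  assume "integral {a..a + 2 * pi} (\<lambda>t. (k' t)\<^sup>2 - (k t)\<^sup>2 / 4) = 0"
  with s2 have s0: "((\<lambda>t. (s t)\<^sup>2) has_integral 0) (cbox a b)" by (simp add: b_def)
  have "(s t)\<^sup>2 = 0" if "t \<in> {a..b}" for t
    by (rule has_integral_0_cbox_imp_0[OF _ _ s0])
       (use that ab in \<open>auto intro!: continuous_intros scont\<close>)
  then have s_zero: "s t = 0" if "t \<in> {a..b}" for t using that by simp
  have "Q t = Q a" if "t \<in> {a..b}" for t
  proof (rule DERIV_isconst2[OF ab Qcont])
    fix x assume x: "a < x" "x < b"
    have num: "k' x * sin ((x - a) / 2) - k x * (cos ((x - a) / 2) / 2) = 0"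
      using s_zero[of x] sin_pos[OF x] x by (simp add: s_def Q_def field_simps)
    then show "(Q has_real_derivative 0) (at x)" using Qint[OF x] unfolding num by simp
  qed (use that in auto)
  then have "k t = Q a * sin ((t - a) / 2)" if "t \<in> {a..b}" for t
  proof (cases "t = a \<or> t = b")
    case True then show ?thesis using zero by (auto simp: b_def)
  next
    case False
    then have "Q t = k t / sin ((t - a) / 2)" "sin ((t - a) / 2) > 0"
      using that sin_pos[of t] by (auto simp: Q_def)
    then show ?thesis using \<open>\<And>t. t \<in> {a..b} \<Longrightarrow> Q t = Q a\<close>[OF that] by (simp add: field_simps)
  qed
  then show "\<exists>c. \<forall>t\<in>{a..a + 2 * pi}. k t = c * sin ((t - a) / 2)"
    by (auto simp: b_def)
qed

lemma integral_period_shift: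
  fixes w :: "real \<Rightarrow> real"
  assumes "continuous_on UNIV w" "\<And>t. w (t + p) = w t" "0 \<le> c" "c \<le> p"
  shows "integral {c..c + p} w = integral {0..p} w"
proof -
  have int: "w integrable_on {x..y}" for x y
    by (intro integrable_continuous_real continuous_on_subset[OF assms(1)]) auto
  have "integral {p..c + p} w = integral {0..c} (w \<circ> (\<lambda>x. x + p))"
    using integral_shift[of 0 p c w, OF continuous_on_subset[OF assms(1)]] by simp
  also have "w \<circ> (\<lambda>x. x + p) = w" using assms by auto
  finally have "integral {p..c + p} w = integral {0..c} w" .
  moreover have "integral {0..c} w + integral {c..p} w = integral {0..p} w"
    using assms int by (intro Henstock_Kurzweil_Integration.integral_combine) auto
  moreover have "integral {c..p} w + integral {p..c + p} w = integral {c..c + p} w"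
    using assms int by (intro Henstock_Kurzweil_Integration.integral_combine) auto
  ultimately show ?thesis by simp
qed

text \<open>A real antiperiodic function changes sign and therefore has a zero; the Dirichlet
  inequality applies to the period that starts there.\<close>

lemma antiperiodic_wirtinger:
  fixes k k' :: "real \<Rightarrow> real"
  assumes k: "\<And>t. (k has_real_derivative k' t) (at t)" and k': "continuous_on UNIV k'"
    and anti: "\<And>t. k (t + 2 * pi) = - k t" "\<And>t. k' (t + 2 * pi) = - k' t"
  shows "0 \<le> integral {0..2 * pi} (\<lambda>t. (k' t)\<^sup>2 - (k t)\<^sup>2 / 4)"
    and "integral {0..2 * pi} (\<lambda>t. (k' t)\<^sup>2 - (k t)\<^sup>2 / 4) = 0 \<Longrightarrow>
      \<exists>p q. \<forall>t. k t = p * cos (t / 2) + q * sin (t / 2)"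
proof -
  have kcont: "continuous_on UNIV k"
    using k by (intro DERIV_continuous_on[of _ _ k']) (auto intro: has_field_derivative_at_within)
  have "\<exists>a. 0 \<le> a \<and> a \<le> 2 * pi \<and> k a = 0"
  proof (cases "k 0 \<le> 0")
    case True
    with anti(1)[of 0] show ?thesis
      by (intro IVT') (auto intro: continuous_on_subset[OF kcont])
  next
    case False
    with anti(1)[of 0] show ?thesis
      by (intro IVT2') (auto intro: continuous_on_subset[OF kcont])
  qed
  then obtain a where a: "0 \<le> a" "a \<le> 2 * pi" "k a = 0" by blast
  have shift: "integral {a..a + 2 * pi} (\<lambda>t. (k' t)\<^sup>2 - (k t)\<^sup>2 / 4)
      = integral {0..2 * pi} (\<lambda>t. (k' t)\<^sup>2 - (k t)\<^sup>2 / 4)"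
    by (rule integral_period_shift) (use a anti in \<open>auto intro!: continuous_intros kcont k'\<close>)
  have zero: "k (a + 2 * pi) = 0" using anti a by simp
  show "0 \<le> integral {0..2 * pi} (\<lambda>t. (k' t)\<^sup>2 - (k t)\<^sup>2 / 4)"
    using dirichlet_wirtinger(1)[OF k k' a(3) zero] shift by simp
  assume "integral {0..2 * pi} (\<lambda>t. (k' t)\<^sup>2 - (k t)\<^sup>2 / 4) = 0"
  with dirichlet_wirtinger(2)[OF k k' a(3) zero] shift
  obtain c where c: "\<And>t. t \<in> {a..a + 2 * pi} \<Longrightarrow> k t = c * sin ((t - a) / 2)" by metis
  define d where "d t = \<bar>k t - c * sin ((t - a) / 2)\<bar>" for t
  have per: "d (t + 2 * pi) = d t" for t
  proof -
    have "sin ((t + 2 * pi - a) / 2) = sin ((t - a) / 2 + pi)"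
      by (rule arg_cong[of _ _ sin]) (simp add: field_simps)
    then show ?thesis by (simp add: d_def anti)
  qed
  interpret periodic_fun_simple d "2 * pi" by standard (rule per)
  have d0: "d t = 0" for t
  proof -
    define n where "n = \<lfloor>(t - a) / (2 * pi)\<rfloor>"
    have "of_int n \<le> (t - a) / (2 * pi)" "(t - a) / (2 * pi) < of_int n + 1"
      unfolding n_def by linarith+
    then have "t - of_int n * (2 * pi) \<in> {a..a + 2 * pi}"
      by (auto simp: field_simps)
    then have "d (t - of_int n * (2 * pi)) = 0" using c by (simp add: d_def)
    then show ?thesis by (simp add: minus_of_int)
  qed
  have "k t = - c * sin (a / 2) * cos (t / 2) + c * cos (a / 2) * sin (t / 2)" for t
    using d0[of t] by (simp add: d_def diff_divide_distrib sin_diff algebra_simps)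
  then show "\<exists>p q. \<forall>t. k t = p * cos (t / 2) + q * sin (t / 2)" by blast
qed

text \<open>The real and imaginary part \<open>k\<close> and \<open>l\<close> of \<open>exp(\<i> t/2) (a + \<i> b)\<close> are antiperiodic, and completing the square gives
  \<open>w = (k'\<^sup>2 + l'\<^sup>2) - (k\<^sup>2 + l\<^sup>2)/4\<close>. The two parts have different zeros, hence they are treated separately.
  On Fourier modes of \<open>a - \<i> b\<close> the form is \<open>m\<^sup>2 - m = (m - 1/2)\<^sup>2 - 1/4\<close>; the factor \<open>exp(\<i> t/2)\<close> is the shift
  by one half.\<close>

lemma loop_inequality:
  fixes a b a' b' :: "real \<Rightarrow> real"
  assumes a: "\<And>t. (a has_real_derivative a' t) (at t)" and b: "\<And>t. (b has_real_derivative b' t) (at t)"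
    and cont: "continuous_on UNIV a'" "continuous_on UNIV b'"
    and per: "\<And>t. a (t + 2 * pi) = a t" "\<And>t. b (t + 2 * pi) = b t"
      "\<And>t. a' (t + 2 * pi) = a' t" "\<And>t. b' (t + 2 * pi) = b' t"
  defines "w \<equiv> \<lambda>t. (a' t)\<^sup>2 + (b' t)\<^sup>2 + a t * b' t - b t * a' t"
  shows "0 \<le> integral {0..2 * pi} w"
    and "integral {0..2 * pi} w = 0 \<Longrightarrow>
      \<exists>\<alpha> \<beta>. \<forall>t. Complex (a t) (- b t) = \<alpha> + \<beta> * cis t"
proof -
  define k where "k t = a t * cos (t / 2) - b t * sin (t / 2)" for t
  define l where "l t = a t * sin (t / 2) + b t * cos (t / 2)" for t
  define k' where "k' t = a' t * cos (t / 2) - b' t * sin (t / 2) - l t / 2" for t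
  define l' where "l' t = a' t * sin (t / 2) + b' t * cos (t / 2) + k t / 2" for t
  have acont: "continuous_on UNIV a" "continuous_on UNIV b"
    using DERIV_continuous_on[of UNIV a a'] DERIV_continuous_on[of UNIV b b'] a b
    by (auto intro: has_field_derivative_at_within)
  have dk: "(k has_real_derivative k' t) (at t)" for t
    unfolding k_def k'_def l_def
    by (auto intro!: derivative_eq_intros a b simp: field_simps)
  have dl: "(l has_real_derivative l' t) (at t)" for t
    unfolding k_def l'_def l_def
    by (auto intro!: derivative_eq_intros a b simp: field_simps)
  have ck: "continuous_on UNIV k'" "continuous_on UNIV l'"
    unfolding k'_def l'_def k_def l_def by (intro continuous_intros cont acont; simp)+
  have half: "(t + 2 * pi) / 2 = t / 2 + pi" for t :: real by (simp add: field_simps)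
  have anti: "k (t + 2 * pi) = - k t" "l (t + 2 * pi) = - l t" for t
    unfolding k_def l_def half by (simp_all add: per)
  have anti': "k' (t + 2 * pi) = - k' t" "l' (t + 2 * pi) = - l' t" for t
    unfolding k'_def l'_def anti unfolding half by (simp_all add: per)
  note W1 = antiperiodic_wirtinger[OF dk ck(1) anti(1) anti'(1)]
  note W2 = antiperiodic_wirtinger[OF dl ck(2) anti(2) anti'(2)]
  have w: "w t = ((k' t)\<^sup>2 - (k t)\<^sup>2 / 4) + ((l' t)\<^sup>2 - (l t)\<^sup>2 / 4)" for t
  proof -
    define c s where "c = cos (t / 2)" and "s = sin (t / 2)"
    have "((k' t)\<^sup>2 - (k t)\<^sup>2 / 4) + ((l' t)\<^sup>2 - (l t)\<^sup>2 / 4) = w t * (c\<^sup>2 + s\<^sup>2)"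
      unfolding w_def k'_def l'_def k_def l_def c_def[symmetric] s_def[symmetric]
      by (simp add: field_simps power2_eq_square)
    then show ?thesis by (simp add: c_def s_def)
  qed
  have kc: "continuous_on UNIV k" "continuous_on UNIV l"
    unfolding k_def l_def by (intro continuous_intros acont; simp)+
  have int: "(\<lambda>t. (k' t)\<^sup>2 - (k t)\<^sup>2 / 4) integrable_on {0..2 * pi}"
    "(\<lambda>t. (l' t)\<^sup>2 - (l t)\<^sup>2 / 4) integrable_on {0..2 * pi}"
    by (auto intro!: integrable_continuous_real continuous_intros intro: continuous_on_subset[OF kc(1)]
      continuous_on_subset[OF kc(2)] continuous_on_subset[OF ck(1)] continuous_on_subset[OF ck(2)])
  have sum: "integral {0..2 * pi} w = integral {0..2 * pi} (\<lambda>t. (k' t)\<^sup>2 - (k t)\<^sup>2 / 4)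
     + integral {0..2 * pi} (\<lambda>t. (l' t)\<^sup>2 - (l t)\<^sup>2 / 4)"
    unfolding w[abs_def] by (rule integral_add[OF int])
  show "0 \<le> integral {0..2 * pi} w"
    using W1(1) W2(1) sum by simp
  assume "integral {0..2 * pi} w = 0"
  then have "integral {0..2 * pi} (\<lambda>t. (k' t)\<^sup>2 - (k t)\<^sup>2 / 4) = 0"
    "integral {0..2 * pi} (\<lambda>t. (l' t)\<^sup>2 - (l t)\<^sup>2 / 4) = 0"
    using W1(1) W2(1) sum by simp_all
  then obtain p q p' q' where k: "\<And>t. k t = p * cos (t / 2) + q * sin (t / 2)"
    and l: "\<And>t. l t = p' * cos (t / 2) + q' * sin (t / 2)"
    using W1(2) W2(2) by blast
  have "Complex (a t) (- b t) = Complex ((p + q') / 2) ((q - p') / 2)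
      + Complex ((p - q') / 2) (- (q + p') / 2) * cis t" for t
  proof -
    define c s where "c = cos (t / 2)" and "s = sin (t / 2)"
    have cs: "c\<^sup>2 = 1 - s\<^sup>2" by (simp add: c_def s_def cos_squared_eq)
    have t: "cos t = 1 - 2 * s\<^sup>2" "sin t = 2 * s * c"
      using cos_double_sin[of "t / 2"] sin_double[of "t / 2"] by (simp_all add: c_def s_def)
    have e: "a t * c - b t * s = p * c + q * s" "a t * s + b t * c = p' * c + q' * s"
      using k[of t] l[of t] by (simp_all add: k_def l_def c_def s_def)
    have "a t = (p * c + q * s) * c + (p' * c + q' * s) * s"
      "b t = (p' * c + q' * s) * c - (p * c + q * s) * s"
      unfolding e[symmetric] using cs by algebra+
    then show ?thesis
      using cs by (simp add: complex_eq_iff t) algebra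
  qed
  then show "\<exists>\<alpha> \<beta>. \<forall>t. Complex (a t) (- b t) = \<alpha> + \<beta> * cis t" by blast
qed

section \<open>The measure of the sphere\<close>

lemma sets_sphere_measure [measurable_cong]:
  "sets sphere_measure = sets (restrict_space borel (sphere 0 1))"
  by (simp add: sphere_measure_def)

lemma space_sphere_measure [simp]: "space sphere_measure = sphere 0 1"
  by (simp add: sphere_measure_def space_scale_measure space_restrict_space)

lemma emeasure_sphere_measure:
  fixes A :: "'a::euclidean_space set"
  assumes "A \<in> sets sphere_measure"
  shows "emeasure sphere_measure A =
    of_nat DIM('a) * emeasure lborel {x \<in> ball 0 1 - {0}. sgn x \<in> A}"
proof -
  have [measurable]: "sgn \<in> restrict_space lborel (ball 0 1 - {0}) \<rightarrow>\<^sub>M restrict_space borel (sphere (0::'a) 1)"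
  proof (rule measurable_restrict_space2)
    show "sgn \<in> space (restrict_space lborel (ball 0 1 - {0})) \<rightarrow> sphere (0::'a) 1"
      by (auto simp: space_restrict_space norm_sgn)
    show "sgn \<in> restrict_space lborel (ball 0 1 - {0}) \<rightarrow>\<^sub>M borel"
      by (rule measurable_restrict_space1) measurable
  qed
  have [measurable]: "A \<in> sets (restrict_space borel (sphere 0 1))"
    using assms by (simp add: sets_sphere_measure)
  have "emeasure (distr (restrict_space lborel (ball 0 1 - {0})) (restrict_space borel (sphere 0 1)) sgn) A
    = emeasure (restrict_space lborel (ball 0 1 - {0})) (sgn -` A \<inter> space (restrict_space lborel (ball 0 1 - {0})))"
    by (rule emeasure_distr) measurable
  also have "\<dots> = emeasure lborel (sgn -` A \<inter> space (restrict_space lborel (ball 0 1 - {0})))"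
    by (rule emeasure_restrict_space) (auto simp: space_restrict_space)
  also have "sgn -` A \<inter> space (restrict_space lborel (ball 0 1 - {0})) = {x \<in> ball 0 1 - {0}. sgn x \<in> A}"
    by (auto simp: space_restrict_space)
  finally show ?thesis by (simp add: sphere_measure_def)
qed

lemma finite_measure_sphere_measure: "finite_measure (sphere_measure :: 'a::euclidean_space measure)"
proof (rule finite_measureI)
  have "emeasure lborel {x \<in> ball (0::'a) 1 - {0}. sgn x \<in> sphere 0 1} \<le> emeasure lborel (ball (0::'a) 1)"
    by (rule emeasure_mono) auto
  also have "\<dots> < \<infinity>" by (rule emeasure_lborel_ball_finite)
  finally have "emeasure lborel {x \<in> ball (0::'a) 1 - {0}. sgn x \<in> sphere 0 1} \<noteq> \<infinity>" by simp
  moreover have "sphere 0 1 \<in> sets (sphere_measure :: 'a measure)"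
    using sets.top[of "sphere_measure :: 'a measure"] by simp
  ultimately show "emeasure (sphere_measure :: 'a measure) (space sphere_measure) \<noteq> \<infinity>"
    by (simp add: emeasure_sphere_measure ennreal_mult_eq_top_iff)
qed

lemma borel_measurable_sphere_measure:
  fixes u :: "'a::euclidean_space \<Rightarrow> real"
  assumes "continuous_on (sphere 0 1) u"
  shows "u \<in> borel_measurable sphere_measure"
  using borel_measurable_continuous_on_restrict[OF assms]
  by (simp add: measurable_cong_sets[OF sets_sphere_measure refl])

lemma integrable_sphere_measure:
  fixes u :: "'a::euclidean_space \<Rightarrow> real"
  assumes "continuous_on (sphere 0 1) u"
  shows "integrable sphere_measure u"
proof -
  interpret finite_measure "sphere_measure :: 'a measure" by (rule finite_measure_sphere_measure)
  have "bounded (u ` sphere 0 1)"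
    by (intro compact_imp_bounded compact_continuous_image assms) simp
  then obtain B where "\<forall>x\<in>sphere 0 1. norm (u x) \<le> B" by (auto simp: bounded_iff)
  then show ?thesis
    by (intro integrable_const_bound[of _ B] borel_measurable_sphere_measure assms AE_I2) auto
qed

text \<open>The sphere measure charges every nonempty relatively open set, because the cone over it is open.\<close>

lemma sphere_integral_nonneg_eq_0:
  fixes u :: "'a::euclidean_space \<Rightarrow> real"
  assumes u: "continuous_on (sphere 0 1) u" and nonneg: "\<And>x. norm x = 1 \<Longrightarrow> 0 \<le> u x"
    and zero: "(LINT x|sphere_measure. u x) = 0" and p: "norm p = 1"
  shows "u p = 0"
proof (rule ccontr)
  assume "u p \<noteq> 0"
  have [measurable]: "u \<in> borel_measurable sphere_measure"
    by (rule borel_measurable_sphere_measure[OF u])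
  have "AE x in sphere_measure. u x = 0"
  proof (subst integral_nonneg_eq_0_iff_AE[symmetric, OF integrable_sphere_measure[OF u]])
    show "AE x in sphere_measure. 0 \<le> u x" by (rule AE_I2) (simp add: nonneg)
  qed (rule zero)
  moreover have meas: "{x \<in> space sphere_measure. u x \<noteq> 0} \<in> sets sphere_measure" by measurable
  ultimately have "emeasure sphere_measure {x \<in> sphere 0 1. u x \<noteq> 0} = 0"
    by (subst (asm) AE_iff_measurable[OF _ refl]) auto
  then have "emeasure lborel {x \<in> ball 0 1 - {0}. sgn x \<in> {x \<in> sphere 0 1. u x \<noteq> 0}} = 0"
    using meas by (subst (asm) emeasure_sphere_measure) auto
  moreover have "{x \<in> ball 0 1 - {0}. sgn x \<in> {x \<in> sphere 0 1. u x \<noteq> 0}}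
      = (ball 0 1 - {0}) \<inter> (\<lambda>x. u (sgn x)) -` (- {0})"
    by (auto simp: norm_sgn)
  ultimately have null: "emeasure lborel ((ball 0 1 - {0}) \<inter> (\<lambda>x. u (sgn x)) -` (- {0})) = 0" by simp
  have "open ((ball 0 1 - {0}) \<inter> (\<lambda>x. u (sgn x)) -` (- {0}))"
    by (intro continuous_open_preimage continuous_on_compose2[OF u] continuous_intros)
       (auto simp: norm_sgn open_delete split: if_splits)
  moreover have "p /\<^sub>R 2 \<in> (ball 0 1 - {0}) \<inter> (\<lambda>x. u (sgn x)) -` (- {0})"
    using p \<open>u p \<noteq> 0\<close> by (auto simp: sgn_div_norm)
  ultimately have op: "open ((ball 0 1 - {0}) \<inter> (\<lambda>x. u (sgn x)) -` (- {0}))"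
    and "\<not> negligible ((ball 0 1 - {0}) \<inter> (\<lambda>x. u (sgn x)) -` (- {0}))"
    using open_not_negligible by blast+
  then show False using null borel_open[OF op] by (simp add: negligible_iff_emeasure0)
qed

lemma emeasure_lborel_orthogonal_vimage:
  fixes Q :: "real^'n::{finite,wellorder} \<Rightarrow> real^'n::_"
  assumes Q: "orthogonal_transformation Q" and B: "B \<in> sets borel" "bounded B"
  shows "emeasure lborel (Q -` B) = emeasure lborel B"
proof -
  have Qm: "Q \<in> borel_measurable borel"
    using Q by (intro borel_measurable_continuous_onI linear_continuous_on)
      (simp add: linear_linear orthogonal_transformation_linear)
  have "Q -` B \<in> sets borel" using measurable_sets[OF Qm B(1)] by simp
  moreover have "bounded (Q -` B)"
    using B(2) orthogonal_transformation_norm[OF Q] unfolding bounded_iff by (metis vimageE)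
  ultimately have L: "Q -` B \<in> lmeasurable" by (intro bounded_set_imp_lmeasurable) simp_all
  have L2: "B \<in> lmeasurable" using B by (intro bounded_set_imp_lmeasurable) simp_all
  have "Q ` (Q -` B) = B"
    using orthogonal_transformation_surj[OF Q] by (rule surj_image_vimage_eq)
  then have "measure lebesgue B = measure lebesgue (Q -` B)"
    using measure_orthogonal_image[OF Q L] by simp
  then have "emeasure lebesgue (Q -` B) = emeasure lebesgue B"
    unfolding emeasure_eq_measure2[OF L] emeasure_eq_measure2[OF L2] by metis
  then show ?thesis using \<open>Q -` B \<in> sets borel\<close> B by simp
qed

text \<open>The cone construction commutes with orthogonal maps, and these preserve Lebesgue measure.\<close>

lemma sphere_integral_orthogonal:
  fixes u :: "real^'n::{finite,wellorder} \<Rightarrow> real" and Q :: "real^'n::_ \<Rightarrow> real^'n::_"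
  assumes Q: "orthogonal_transformation Q" and u: "continuous_on (sphere 0 1) u"
  shows "(LINT x|sphere_measure. u (Q x)) = (LINT x|sphere_measure. u x)"
proof -
  note [simp] = orthogonal_transformation_norm[OF Q]
  have Qcont: "continuous_on X Q" for X
    using Q by (intro linear_continuous_on) (simp add: linear_linear orthogonal_transformation_linear)
  have "Q \<in> restrict_space borel (sphere 0 1) \<rightarrow>\<^sub>M restrict_space borel (sphere 0 1)"
    by (rule measurable_restrict_space2)
       (auto simp: space_restrict_space intro: borel_measurable_continuous_on_restrict Qcont)
  then have Qmeas [measurable]: "Q \<in> sphere_measure \<rightarrow>\<^sub>M sphere_measure"
    by (simp add: measurable_cong_sets[OF sets_sphere_measure sets_sphere_measure])
  have "distr sphere_measure sphere_measure Q = sphere_measure"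
  proof (rule measure_eqI)
    fix A assume "A \<in> sets (distr sphere_measure sphere_measure Q)"
    then have A [measurable]: "A \<in> sets sphere_measure" by simp
    have AS: "A \<subseteq> sphere 0 1" using sets.sets_into_space[OF A] by simp
    have Ab: "A \<in> sets borel"
      using A by (simp add: sets_sphere_measure sets_restrict_space_iff)
    have sgnQ: "sgn (Q x) = Q (sgn x)" for x
      using orthogonal_transformation_linear[OF Q] by (simp add: sgn_div_norm linear_scale)
    have "emeasure (distr sphere_measure sphere_measure Q) A
        = emeasure sphere_measure (Q -` A \<inter> sphere 0 1)"
      by (simp add: emeasure_distr)
    also have "\<dots> = of_nat DIM(real^'n::{finite,wellorder}) * emeasure lborel {x \<in> ball 0 1 - {0}. sgn x \<in> Q -` A \<inter> sphere 0 1}"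
      by (rule emeasure_sphere_measure)
         (use measurable_sets[OF Qmeas A] in simp)
    also have "{x \<in> ball 0 1 - {0}. sgn x \<in> Q -` A \<inter> sphere 0 1}
        = Q -` {x \<in> ball 0 1 - {0}. sgn x \<in> A}"
    proof -
      have "Q x = 0 \<longleftrightarrow> x = 0" for x using orthogonal_transformation_norm[OF Q, of x] by (metis norm_eq_zero)
      then show ?thesis using AS by (auto simp: sgnQ norm_sgn)
    qed
    also have "emeasure lborel \<dots> = emeasure lborel {x \<in> ball 0 1 - {0}. sgn x \<in> A}"
    proof (rule emeasure_lborel_orthogonal_vimage[OF Q])
      have "{x \<in> ball 0 1 - {0}. sgn x \<in> A} = (ball 0 1 - {0}) \<inter> (sgn -` A)" by auto
      then show "{x \<in> ball 0 1 - {0}. sgn x \<in> A} \<in> sets borel"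
        using measurable_sets[OF borel_measurable_sgn Ab] by simp
    qed (auto intro: bounded_subset[of "ball 0 1"])
    also have "of_nat DIM(real^'n::{finite,wellorder}) * \<dots> = emeasure sphere_measure A"
      using A by (simp add: emeasure_sphere_measure)
    finally show "emeasure (distr sphere_measure sphere_measure Q) A = emeasure sphere_measure A" .
  qed simp
  then have "(LINT x|sphere_measure. u x) = (LINT x|distr sphere_measure sphere_measure Q. u x)" by metis
  also have "\<dots> = (LINT x|sphere_measure. u (Q x))"
    by (rule integral_distr[OF Qmeas borel_measurable_sphere_measure[OF u]])
  finally show ?thesis by simp
qed

text \<open>Fubini's theorem together with invariance: integrating over the sphere may be done by
  integrating first along the orbits of a family of isometries.\<close>

lemma sphere_integral_orbit_average:
  fixes u :: "real^'n::{finite,wellorder} \<Rightarrow> real" and R :: "real \<Rightarrow> real^'n::_ \<Rightarrow> real^'n::_"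
  assumes R: "\<And>t. orthogonal_transformation (R t)" and Rcont: "continuous_on UNIV (\<lambda>(x, t). R t x)"
    and u: "continuous_on (sphere 0 1) u" and c: "0 \<le> c"
  shows "(LINT x|sphere_measure. integral {0..c} (\<lambda>t. u (R t x))) = c * (LINT x|sphere_measure. u x)"
proof -
  define N where "N = restrict_space lborel {0..c}"
  \<comment> \<open>The extension by zero is Borel on the whole space, where the flow is jointly measurable.\<close>
  define v where "v x = (if x \<in> sphere 0 1 then u x else 0)" for x
  have normR: "norm (R t x) = norm x" for t x by (rule orthogonal_transformation_norm[OF R])
  interpret M: finite_measure "sphere_measure :: (real^'n::{finite,wellorder}) measure" by (rule finite_measure_sphere_measure)
  have N: "finite_measure N"
    by (rule finite_measureI) (use c in \<open>auto simp: N_def space_restrict_space emeasure_restrict_space\<close>)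
  interpret N: finite_measure N by (rule N)
  interpret P: pair_sigma_finite "sphere_measure :: (real^'n::{finite,wellorder}) measure" N ..
  interpret PF: finite_measure "(sphere_measure :: (real^'n::{finite,wellorder}) measure) \<Otimes>\<^sub>M N"
    by (rule finite_measure_pair_measure[OF N finite_measure_sphere_measure])
  have [measurable]: "v \<in> borel_measurable borel"
    unfolding v_def by (intro borel_measurable_continuous_on_if u) auto
  have [measurable]: "(\<lambda>x. x) \<in> sphere_measure \<rightarrow>\<^sub>M (borel :: (real^'n::{finite,wellorder}) measure)"
    by (subst measurable_cong_sets[OF sets_sphere_measure refl]) (rule measurable_restrict_space1, simp)
  have [measurable]: "(\<lambda>x. x) \<in> N \<rightarrow>\<^sub>M borel"
    unfolding N_def by (rule measurable_restrict_space1) simp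
  have [measurable]: "(\<lambda>(x, t). R t x) \<in> borel \<Otimes>\<^sub>M borel \<rightarrow>\<^sub>M borel"
    using borel_measurable_continuous_onI[OF Rcont] by (simp add: borel_prod)
  have pair: "(\<lambda>p :: (real^'n::{finite,wellorder}) \<times> real. (fst p, snd p)) \<in> ((sphere_measure :: (real^'n::{finite,wellorder}) measure) \<Otimes>\<^sub>M N) \<rightarrow>\<^sub>M (borel \<Otimes>\<^sub>M borel)"
  proof (rule measurable_Pair)
    show "fst \<in> ((sphere_measure :: (real^'n::{finite,wellorder}) measure) \<Otimes>\<^sub>M N) \<rightarrow>\<^sub>M (borel :: (real^'n::{finite,wellorder}) measure)"
      by (rule measurable_compose[OF measurable_fst]) fact
    show "snd \<in> ((sphere_measure :: (real^'n::{finite,wellorder}) measure) \<Otimes>\<^sub>M N) \<rightarrow>\<^sub>M borel"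
      by (rule measurable_compose[OF measurable_snd]) fact
  qed
  have "(\<lambda>p. v ((\<lambda>(x, t). R t x) (fst p, snd p))) \<in> borel_measurable ((sphere_measure :: (real^'n::{finite,wellorder}) measure) \<Otimes>\<^sub>M N)"
    by (rule measurable_compose[OF pair]) measurable
  then have meas: "(\<lambda>(x, t). v (R t x)) \<in> borel_measurable (sphere_measure \<Otimes>\<^sub>M N)"
    by (simp add: case_prod_beta)
  have "bounded (u ` sphere 0 1)"
    by (intro compact_imp_bounded compact_continuous_image u) simp
  then obtain B where "\<forall>x\<in>sphere 0 1. norm (u x) \<le> B" by (auto simp: bounded_iff)
  then have "norm (v x) \<le> max B 0" for x by (auto simp: v_def max_def dest: bspec[where x=x])
  then have int: "integrable (sphere_measure \<Otimes>\<^sub>M N) (\<lambda>(x, t). v (R t x))"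
    by (intro PF.integrable_const_bound[of _ "max B 0"] meas AE_I2) auto
  have inner: "(LINT t|N. v (R t x)) = integral {0..c} (\<lambda>t. u (R t x))" if "norm x = 1" for x
  proof -
    have cont: "continuous_on {0..c} (\<lambda>t. u (R t x))"
      by (rule continuous_on_compose2[OF u], rule continuous_on_compose2[OF Rcont, of _ "\<lambda>t. (x, t)", simplified])
         (auto intro!: continuous_intros simp: normR that)
    have "(LINT t|N. v (R t x)) = (LINT t:{0..c}|lborel. u (R t x))"
      unfolding N_def set_lebesgue_integral_def
      by (subst integral_restrict_space) (auto simp: v_def normR that)
    also have "\<dots> = integral {0..c} (\<lambda>t. u (R t x))"
      by (intro set_borel_integral_eq_integral borel_integrable_atLeastAtMost' cont)
    finally show ?thesis .
  qed
  have "(LINT x|sphere_measure. integral {0..c} (\<lambda>t. u (R t x)))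
      = (LINT x|sphere_measure. LINT t|N. v (R t x))"
    by (rule Bochner_Integration.integral_cong) (auto simp: inner)
  also have "\<dots> = (LINT t|N. LINT x|sphere_measure. v (R t x))"
    by (rule P.Fubini_integral[symmetric]) (rule int)
  also have "\<dots> = (LINT t|N. LINT x|sphere_measure. u x)"
  proof (rule Bochner_Integration.integral_cong)
    fix t
    have "(LINT x|sphere_measure. v (R t x)) = (LINT x|sphere_measure. u (R t x))"
      by (rule Bochner_Integration.integral_cong) (auto simp: v_def normR)
    then show "(LINT x|sphere_measure. v (R t x)) = (LINT x|sphere_measure. u x)"
      using sphere_integral_orthogonal[OF R u] by simp
  qed simp
  also have "\<dots> = c * (LINT x|sphere_measure. u x)"
    using c by (simp add: N_def measure_restrict_space space_restrict_space)
  finally show ?thesis .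
qed

section \<open>Differentiation along isometric circle actions\<close>

definition orthogonal_complex_structure :: "('a::euclidean_space \<Rightarrow> 'a) \<Rightarrow> bool" where
  "orthogonal_complex_structure J \<longleftrightarrow> orthogonal_transformation J \<and> (\<forall>x. J (J x) = - x)"

text \<open>The one-parameter group \<open>exp(t J)\<close>; for \<open>J\<^sup>2 = -1\<close> it is a circle action by rotations.\<close>

definition flow :: "('a::euclidean_space \<Rightarrow> 'a) \<Rightarrow> real \<Rightarrow> 'a \<Rightarrow> 'a" where
  "flow J t x = cos t *\<^sub>R x + sin t *\<^sub>R J x"

text \<open>Defined through the orbit, which stays on the sphere, so that only values on the sphere matter
  and complex-valued functions are covered.\<close>

definition along :: "('a::euclidean_space \<Rightarrow> 'a) \<Rightarrow> ('a \<Rightarrow> 'b::real_normed_vector) \<Rightarrow> 'a \<Rightarrow> 'b" where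
  "along J f x = vector_derivative (\<lambda>t. f (flow J t x)) (at 0)"

definition C1_on_sphere :: "('a::euclidean_space \<Rightarrow> real) \<Rightarrow> bool" where
  "C1_on_sphere f \<longleftrightarrow>
     (\<forall>p\<in>sphere 0 1. \<exists>U F. open U \<and> p \<in> U \<and> Ck_on 1 U F \<and> (\<forall>x\<in>U \<inter> sphere 0 1. F x = f x))"

lemma orthogonal_complex_structureD:
  assumes "orthogonal_complex_structure J"
  shows "linear J" "norm (J x) = norm x" "J x \<bullet> J y = x \<bullet> y" "J (J x) = - x"
    "x \<bullet> J y = - (J x \<bullet> y)"
proof -
  show *: "linear J" "norm (J x) = norm x" "J x \<bullet> J y = x \<bullet> y" "J (J x) = - x" for x y
    using assms orthogonal_transformation_norm[of J x]
    by (auto simp: orthogonal_complex_structure_def orthogonal_transformation_def)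
  show "x \<bullet> J y = - (J x \<bullet> y)" using *(3)[of x "J y"] by (simp add: *(4))
qed

lemma flow_0 [simp]: "flow J 0 x = x"
  by (simp add: flow_def)

lemma flow_2pi: "flow J (t + 2 * pi) x = flow J t x"
  by (simp add: flow_def)

context
  fixes J :: "'a::euclidean_space \<Rightarrow> 'a"
  assumes J: "orthogonal_complex_structure J"
begin

lemmas J_props = orthogonal_complex_structureD[OF J]

lemma orthogonal_transformation_flow: "orthogonal_transformation (flow J t)"
  unfolding orthogonal_transformation_def
proof (intro conjI allI)
  interpret linear J by (rule J_props)
  show "linear (flow J t)"
    by (rule linearI) (simp_all add: flow_def add scale algebra_simps)
  fix v w
  have "flow J t v \<bullet> flow J t w = (cos t)\<^sup>2 * (v \<bullet> w) + cos t * sin t * (v \<bullet> J w)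
      + sin t * cos t * (J v \<bullet> w) + (sin t)\<^sup>2 * (J v \<bullet> J w)"
    by (simp add: flow_def inner_add_left inner_add_right algebra_simps power2_eq_square)
  also have "\<dots> = ((cos t)\<^sup>2 + (sin t)\<^sup>2) * (v \<bullet> w)"
    unfolding J_props(3) J_props(5)[of v w] by (simp only: ring_distribs mult_minus_right) simp
  finally have "flow J t v \<bullet> flow J t w = ((cos t)\<^sup>2 + (sin t)\<^sup>2) * (v \<bullet> w)" .
  then show "flow J t v \<bullet> flow J t w = v \<bullet> w" by simp
qed

lemma norm_flow [simp]: "norm (flow J t x) = norm x"
  by (rule orthogonal_transformation_norm[OF orthogonal_transformation_flow])

lemma flow_flow: "flow J s (flow J t x) = flow J (s + t) x"
proof -
  interpret linear J by (rule J_props)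
  show ?thesis
    by (simp add: flow_def add scale J_props(4) cos_add sin_add algebra_simps)
qed

lemma flow_pi: "flow J pi x = - x"
  by (simp add: flow_def)

lemma flow_scaleR: "flow J t (c *\<^sub>R x) = c *\<^sub>R flow J t x"
  using J_props(1) by (simp add: flow_def linear_scale algebra_simps)

lemma bounded_linear_J: "bounded_linear J"
  using J_props(1) by (simp add: linear_linear)

lemma has_vector_derivative_flow:
  "((\<lambda>t. flow J t x) has_vector_derivative J (flow J t x)) (at t)"
proof -
  interpret linear J by (rule J_props)
  have "((\<lambda>t. flow J t x) has_vector_derivative (- sin t) *\<^sub>R x + cos t *\<^sub>R J x) (at t)"
    unfolding flow_def
    by (auto intro!: derivative_eq_intros)
  then show ?thesis by (simp add: flow_def add scale J_props(4) algebra_simps)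
qed

lemma continuous_on_flow: "continuous_on X (\<lambda>(x, t). flow J t x)"
  unfolding flow_def case_prod_beta
  by (intro continuous_intros bounded_linear.continuous_on[OF bounded_linear_J])

text \<open>Relates the intrinsic derivative along an orbit to the differential of any local extension to the ambient space.\<close>

lemma has_vector_derivative_along_local:
  assumes U: "open U" "x \<in> U" "F differentiable (at x)" and x: "norm x = 1"
    and eq: "\<forall>y\<in>U \<inter> sphere 0 1. F y = f y"
  shows "((\<lambda>t. f (flow J t x)) has_vector_derivative frechet_derivative F (at x) (J x)) (at 0)"
proof (rule has_vector_derivative_transform_within_open)
  have "(F has_derivative frechet_derivative F (at x)) (at (flow J 0 x))"
    using U(3) by (simp add: frechet_derivative_works)
  from vector_derivative_diff_chain_within[OF has_vector_derivative_flow has_derivative_at_withinI[OF this]]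
  show "((\<lambda>t. F (flow J t x)) has_vector_derivative frechet_derivative F (at x) (J x)) (at 0)"
    by (simp add: o_def)
  have "continuous_on UNIV (\<lambda>t. flow J t x)"
    unfolding flow_def by (intro continuous_intros)
  then show "open ((\<lambda>t. flow J t x) -` U)"
    using U(1) by (auto intro: open_vimage)
qed (use U x eq in auto)

lemma along_local:
  assumes "open U" "x \<in> U" "F differentiable (at x)" and "norm x = 1"
    and "\<forall>y\<in>U \<inter> sphere 0 1. F y = f y"
  shows "along J f x = frechet_derivative F (at x) (J x)"
  unfolding along_def by (rule vector_derivative_at[OF has_vector_derivative_along_local[OF assms]])

lemma has_vector_derivative_flow_shift:
  assumes "((\<lambda>s. f (flow J s (flow J t x))) has_vector_derivative d) (at 0)"
  shows "((\<lambda>t. f (flow J t x)) has_vector_derivative d) (at t)"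
proof -
  have "((\<lambda>s. f (flow J s (flow J t x))) \<circ> (\<lambda>s. s - t) has_vector_derivative 1 *\<^sub>R d) (at t)"
    by (rule vector_diff_chain_at) (use assms in \<open>auto intro!: derivative_eq_intros\<close>)
  then show ?thesis by (simp add: o_def flow_flow)
qed

lemma C1_on_sphere_derivative:
  assumes f: "C1_on_sphere f" and x: "norm x = 1"
  shows "((\<lambda>t. f (flow J t x)) has_real_derivative along J f (flow J t x)) (at t)"
proof -
  have y: "norm (flow J t x) = 1" using x by simp
  then obtain U F where U: "open U" "flow J t x \<in> U" "Ck_on 1 U F" "\<forall>x\<in>U \<inter> sphere 0 1. F x = f x"
    using f unfolding C1_on_sphere_def by (metis mem_sphere_0)
  have F: "F differentiable (at (flow J t x))" using U by simp
  show ?thesis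
    using has_vector_derivative_along_local[OF U(1,2) F y U(4)]
    unfolding has_real_derivative_iff_has_vector_derivative along_local[OF U(1,2) F y U(4)]
    by (rule has_vector_derivative_flow_shift)
qed

end

lemma continuous_on_sphere_local:
  assumes "\<And>p. norm p = 1 \<Longrightarrow> \<exists>U G. open U \<and> p \<in> U \<and> continuous_on U G \<and> (\<forall>x\<in>U \<inter> sphere 0 1. G x = g x)"
  shows "continuous_on (sphere 0 1) g"
  unfolding continuous_on_eq_continuous_within
proof
  fix p :: 'a assume p: "p \<in> sphere 0 1"
  then obtain U G where U: "open U" "p \<in> U" "continuous_on U G" "\<forall>x\<in>U \<inter> sphere 0 1. G x = g x"
    using assms[of p] by auto
  have "continuous_on (U \<inter> sphere 0 1) g"
    using continuous_on_subset[OF U(3)] U(4) by (metis continuous_on_cong inf_le1)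
  then have "continuous (at p within U \<inter> sphere 0 1) g"
    using U p by (simp add: continuous_on_eq_continuous_within)
  moreover have "at p within U \<inter> sphere 0 1 = at p within sphere 0 1"
    by (rule at_within_nhd[OF U(2,1)]) auto
  ultimately show "continuous (at p within sphere 0 1) g" by simp
qed

lemma Ck_on_1_continuous:
  assumes "Ck_on (Suc k) U F"
  shows "continuous_on U F"
  using assms by (auto intro: continuous_at_imp_continuous_on differentiable_imp_continuous_within)

lemma frechet_derivative_basis:
  fixes F :: "'a::euclidean_space \<Rightarrow> real"
  assumes "F differentiable (at x)"
  shows "frechet_derivative F (at x) v = (\<Sum>b\<in>Basis. (v \<bullet> b) * frechet_derivative F (at x) b)"
proof -
  interpret linear "frechet_derivative F (at x)" by (rule linear_frechet_derivative[OF assms])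
  show ?thesis
    by (subst (1) euclidean_representation[of v, symmetric]) (simp add: sum scale)
qed

lemma C1_on_sphere_continuous:
  assumes "C1_on_sphere f"
  shows "continuous_on (sphere 0 1) f"
proof (rule continuous_on_sphere_local)
  fix p :: 'a assume "norm p = 1"
  then obtain U F where "open U" "p \<in> U" "Ck_on 1 U F" "\<forall>x\<in>U \<inter> sphere 0 1. F x = f x"
    using assms unfolding C1_on_sphere_def by (metis mem_sphere_0)
  then show "\<exists>U G. open U \<and> p \<in> U \<and> continuous_on U G \<and> (\<forall>x\<in>U \<inter> sphere 0 1. G x = f x)"
    using Ck_on_1_continuous[of 0 U F] by auto
qed

lemma C1_on_sphere_continuous_along:
  assumes J: "orthogonal_complex_structure J" and f: "C1_on_sphere f"
  shows "continuous_on (sphere 0 1) (along J f)"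
proof (rule continuous_on_sphere_local)
  fix p :: 'a assume p: "norm p = 1"
  then obtain U F where U: "open U" "p \<in> U" "Ck_on 1 U F" "\<forall>x\<in>U \<inter> sphere 0 1. F x = f x"
    using f unfolding C1_on_sphere_def by (metis mem_sphere_0)
  let ?G = "\<lambda>x. \<Sum>b\<in>Basis. (J x \<bullet> b) * frechet_derivative F (at x) b"
  have "continuous_on U ?G"
    using U(3) by (intro continuous_intros bounded_linear.continuous_on[OF bounded_linear_J[OF J]]) auto
  moreover have "?G x = along J f x" if "x \<in> U \<inter> sphere 0 1" for x
    using along_local[OF J U(1) _ _ _ U(4)] frechet_derivative_basis[of F x "J x"] U(3) that by auto
  ultimately show "\<exists>U G. open U \<and> p \<in> U \<and> continuous_on U G \<and> (\<forall>x\<in>U \<inter> sphere 0 1. G x = along J f x)"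
    using U by blast
qed

lemma smooth_on_sphere_imp_C1: "smooth_on_sphere f \<Longrightarrow> C1_on_sphere f"
  unfolding smooth_on_sphere_def C1_on_sphere_def by blast

lemma Ck_on_1I:
  assumes "\<And>x. x \<in> U \<Longrightarrow> (F has_derivative D x) (at x)"
    and "\<And>b. b \<in> Basis \<Longrightarrow> continuous_on U (\<lambda>x. D x b)"
  shows "Ck_on 1 U F"
proof -
  have "frechet_derivative F (at x) = D x" if "x \<in> U" for x
    using frechet_derivative_at[OF assms(1)[OF that]] by simp
  then show ?thesis
    using assms by (auto simp: differentiable_def cong: continuous_on_cong)
qed

lemma directional_has_derivative:
  fixes F :: "'a::euclidean_space \<Rightarrow> real"
  assumes J: "bounded_linear J" and F: "Ck_on (Suc (Suc k)) U F" and x: "x \<in> U"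
  shows "((\<lambda>x. \<Sum>b\<in>Basis. (J x \<bullet> b) * frechet_derivative F (at x) b) has_derivative
     (\<lambda>v. frechet_derivative F (at x) (J v)
        + (\<Sum>b\<in>Basis. (J x \<bullet> b) * frechet_derivative (\<lambda>y. frechet_derivative F (at y) b) (at x) v))) (at x)"
proof -
  have 1: "((\<lambda>y. frechet_derivative F (at y) b) has_derivative
      frechet_derivative (\<lambda>y. frechet_derivative F (at y) b) (at x)) (at x)" if "b \<in> Basis" for b
    using F x that by (auto simp: frechet_derivative_works)
  have 2: "((\<lambda>x. J x \<bullet> b) has_derivative (\<lambda>v. J v \<bullet> b)) (at x)" for b
    using bounded_linear_imp_has_derivative[OF J] by (rule has_derivative_inner_left)
  have "((\<lambda>x. \<Sum>b\<in>Basis. (J x \<bullet> b) * frechet_derivative F (at x) b) has_derivative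
     (\<lambda>v. \<Sum>b\<in>Basis. (J x \<bullet> b) * frechet_derivative (\<lambda>y. frechet_derivative F (at y) b) (at x) v
         + (J v \<bullet> b) * frechet_derivative F (at x) b)) (at x)"
    by (intro has_derivative_sum has_derivative_mult 1 2)
  moreover have "F differentiable (at x)" using F x by simp
  ultimately show ?thesis
    by (simp add: sum.distrib frechet_derivative_basis[of F x "J _"] add.commute)
qed

text \<open>If \<open>F\<close> extends \<open>f\<close> locally, then \<open>x \<mapsto> DF(x)(J x)\<close> extends the derivative of \<open>f\<close> along \<open>J\<close>.\<close>

lemma smooth_on_sphere_along_C1:
  assumes J: "orthogonal_complex_structure J" and f: "smooth_on_sphere f"
  shows "C1_on_sphere (along J f)"
  unfolding C1_on_sphere_def
proof
  fix p :: 'a assume "p \<in> sphere 0 1"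
  then obtain U F where U: "open U" "p \<in> U" "\<forall>k. Ck_on k U F" "\<forall>x\<in>U \<inter> sphere 0 1. F x = f x"
    using f unfolding smooth_on_sphere_def by metis
  let ?G = "\<lambda>x. \<Sum>b\<in>Basis. (J x \<bullet> b) * frechet_derivative F (at x) b"
  have F2: "Ck_on (Suc (Suc 0)) U F" using U(3) by blast
  have F1: "F differentiable (at x)" if "x \<in> U" for x using F2 that by simp
  have "Ck_on 1 U ?G"
  proof (rule Ck_on_1I)
    show "(?G has_derivative (\<lambda>v. frechet_derivative F (at x) (J v)
        + (\<Sum>b\<in>Basis. (J x \<bullet> b) * frechet_derivative (\<lambda>y. frechet_derivative F (at y) b) (at x) v))) (at x)"
      if "x \<in> U" for x
      by (rule directional_has_derivative[OF bounded_linear_J[OF J] F2 that])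
    fix c :: 'a assume c: "c \<in> Basis"
    have "continuous_on U (\<lambda>x. \<Sum>b\<in>Basis. (J c \<bullet> b) * frechet_derivative F (at x) b)"
      using F2 by (intro continuous_intros Ck_on_1_continuous[of 0]) simp
    then have "continuous_on U (\<lambda>x. frechet_derivative F (at x) (J c))"
      by (rule continuous_on_eq) (simp add: frechet_derivative_basis[OF F1, of _ "J c"])
    then show "continuous_on U (\<lambda>x. frechet_derivative F (at x) (J c)
        + (\<Sum>b\<in>Basis. (J x \<bullet> b) * frechet_derivative (\<lambda>y. frechet_derivative F (at y) b) (at x) c))"
      using F2 c by (intro continuous_intros bounded_linear.continuous_on[OF bounded_linear_J[OF J]]) auto
  qed
  moreover have "?G x = along J f x" if "x \<in> U \<inter> sphere 0 1" for x
    using along_local[OF J U(1) _ _ _ U(4)] frechet_derivative_basis[of F x "J x"] F1 that by auto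
  ultimately show "\<exists>U G. open U \<and> p \<in> U \<and> Ck_on 1 U G \<and> (\<forall>x\<in>U \<inter> sphere 0 1. G x = along J f x)"
    using U by blast
qed

lemma line_derivative:
  fixes F :: "'a::euclidean_space \<Rightarrow> real"
  assumes "F differentiable (at (p + s *\<^sub>R b))"
  shows "((\<lambda>s. F (p + s *\<^sub>R b)) has_real_derivative frechet_derivative F (at (p + s *\<^sub>R b)) b) (at s)"
proof -
  have "((\<lambda>s. p + s *\<^sub>R b) has_vector_derivative b) (at s)"
    by (auto intro!: derivative_eq_intros)
  from vector_derivative_diff_chain_within[OF this has_derivative_at_withinI]
  show ?thesis
    using assms unfolding has_real_derivative_iff_has_vector_derivative frechet_derivative_works by (auto simp: o_def)
qed

text \<open>The mean value theorem, once in each direction; the left-hand side is symmetric in the two directions,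
  which yields the symmetry of second derivatives.\<close>

lemma mixed_difference:
  fixes F :: "'a::euclidean_space \<Rightarrow> real"
  assumes F: "\<And>y. dist x y \<le> 2 * h \<Longrightarrow> F differentiable (at y)"
      "\<And>y. dist x y \<le> 2 * h \<Longrightarrow> (\<lambda>y. frechet_derivative F (at y) b) differentiable (at y)"
    and h: "h > 0" and bc: "norm b = 1" "norm c = 1"
  shows "\<exists>y. dist x y \<le> 2 * h \<and> F (x + h *\<^sub>R b + h *\<^sub>R c) - F (x + h *\<^sub>R b) - F (x + h *\<^sub>R c) + F x
    = h\<^sup>2 * frechet_derivative (\<lambda>y. frechet_derivative F (at y) b) (at y) c"
proof -
  have near: "dist x (x + s *\<^sub>R b + t *\<^sub>R c) \<le> 2 * h" if "0 \<le> s" "s \<le> h" "0 \<le> t" "t \<le> h" for s t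
  proof -
    have "norm (s *\<^sub>R b + t *\<^sub>R c) \<le> norm (s *\<^sub>R b) + norm (t *\<^sub>R c)" by (rule norm_triangle_ineq)
    also have "\<dots> \<le> 2 * h" using that bc by simp
    finally show ?thesis by (simp add: dist_norm norm_minus_commute add_ac)
  qed
  let ?d = "\<lambda>y. frechet_derivative F (at y) b"
  have near0: "dist x (x + s *\<^sub>R b) \<le> 2 * h" if "0 \<le> s" "s \<le> h" for s
    using near[OF that, of 0] h by simp
  have "\<exists>z. 0 < z \<and> z < h \<and> (F (x + h *\<^sub>R c + h *\<^sub>R b) - F (x + h *\<^sub>R b)) - (F (x + h *\<^sub>R c + 0 *\<^sub>R b) - F (x + 0 *\<^sub>R b))
      = (h - 0) * (?d (x + h *\<^sub>R c + z *\<^sub>R b) - ?d (x + z *\<^sub>R b))"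
    using h near[of _ h] near0
    by (intro MVT2 DERIV_diff line_derivative F) (auto simp: add_ac)
  then obtain z where z: "0 < z" "z < h" "F (x + h *\<^sub>R b + h *\<^sub>R c) - F (x + h *\<^sub>R b) - F (x + h *\<^sub>R c) + F x
      = h * (?d (x + z *\<^sub>R b + h *\<^sub>R c) - ?d (x + z *\<^sub>R b))" by (auto simp: add_ac)
  have "\<exists>w. 0 < w \<and> w < h \<and> ?d (x + z *\<^sub>R b + h *\<^sub>R c) - ?d (x + z *\<^sub>R b + 0 *\<^sub>R c)
      = (h - 0) * frechet_derivative ?d (at (x + z *\<^sub>R b + w *\<^sub>R c)) c"
    using h near[of z] z by (intro MVT2 line_derivative F) auto
  then obtain w where w: "0 < w" "w < h" "?d (x + z *\<^sub>R b + h *\<^sub>R c) - ?d (x + z *\<^sub>R b)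
      = h * frechet_derivative ?d (at (x + z *\<^sub>R b + w *\<^sub>R c)) c" by auto
  show ?thesis
    using z w near[of z w] by (intro exI[of _ "x + z *\<^sub>R b + w *\<^sub>R c"]) (simp add: power2_eq_square)
qed

lemma symmetric_second_derivative:
  fixes F :: "'a::euclidean_space \<Rightarrow> real"
  assumes U: "open U" "x \<in> U" and F: "Ck_on (Suc (Suc 0)) U F" and bc: "b \<in> Basis" "c \<in> Basis"
  shows "frechet_derivative (\<lambda>y. frechet_derivative F (at y) b) (at x) c
    = frechet_derivative (\<lambda>y. frechet_derivative F (at y) c) (at x) b"
proof -
  define P where "P y = frechet_derivative (\<lambda>y. frechet_derivative F (at y) b) (at y) c" for y
  define R where "R y = frechet_derivative (\<lambda>y. frechet_derivative F (at y) c) (at y) b" for y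
  obtain r where r: "r > 0" "ball x r \<subseteq> U" using U openE by blast
  define h where "h n = r / 3 / real (Suc n)" for n
  have h: "h n > 0" "2 * h n < r" for n
  proof -
    have "r / 3 / real (Suc n) \<le> r / 3" using r by (simp add: field_simps)
    then show "h n > 0" "2 * h n < r" using r by (auto simp: h_def)
  qed
  have inU: "y \<in> U" if "dist x y \<le> 2 * h n" for y n
    using h(2)[of n] that r by (auto simp: subset_iff)
  have "\<exists>y z. dist x y \<le> 2 * h n \<and> dist x z \<le> 2 * h n \<and> P y = R z" for n
  proof -
    have "\<exists>y. dist x y \<le> 2 * h n \<and> F (x + h n *\<^sub>R b + h n *\<^sub>R c) - F (x + h n *\<^sub>R b) - F (x + h n *\<^sub>R c) + F x
        = (h n)\<^sup>2 * P y"
      unfolding P_def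
      by (rule mixed_difference) (use F bc inU h in \<open>auto simp: norm_Basis\<close>)
    moreover have "\<exists>y. dist x y \<le> 2 * h n \<and> F (x + h n *\<^sub>R c + h n *\<^sub>R b) - F (x + h n *\<^sub>R c) - F (x + h n *\<^sub>R b) + F x
        = (h n)\<^sup>2 * R y"
      unfolding R_def
      by (rule mixed_difference) (use F bc inU h in \<open>auto simp: norm_Basis\<close>)
    ultimately obtain y z where yz: "dist x y \<le> 2 * h n" "dist x z \<le> 2 * h n" "(h n)\<^sup>2 * P y = (h n)\<^sup>2 * R z"
      by (auto simp: algebra_simps)
    then have "P y = R z" using h(1)[of n] by simp
    then show ?thesis using yz by blast
  qed
  then obtain y z where yz: "\<And>n. dist x (y n) \<le> 2 * h n" "\<And>n. dist x (z n) \<le> 2 * h n" "\<And>n. P (y n) = R (z n)"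
    by metis
  have h0: "(\<lambda>n. 2 * h n) \<longlonglongrightarrow> 0"
    unfolding h_def by (intro tendsto_mult_right_zero LIMSEQ_Suc[OF lim_const_over_n])
  have lim: "w \<longlonglongrightarrow> x" if "\<And>n. dist x (w n) \<le> 2 * h n" for w
    by (rule metric_tendsto_imp_tendsto[OF h0]) (use that in \<open>auto simp: dist_commute abs_of_pos h less_imp_le\<close>)
  have "isCont P x" "isCont R x"
    using F bc U unfolding P_def R_def by (auto simp: continuous_on_eq_continuous_at)
  then have "(\<lambda>n. P (y n)) \<longlonglongrightarrow> P x" "(\<lambda>n. R (z n)) \<longlonglongrightarrow> R x"
    using isCont_tendsto_compose[OF _ lim[OF yz(1)]] isCont_tendsto_compose[OF _ lim[OF yz(2)]] by blast+
  then show ?thesis using LIMSEQ_unique yz(3) unfolding P_def R_def by auto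
qed

text \<open>The second derivatives of a local extension cancel by symmetry, and what remains is its differential \<open>D\<close> on
  the commutator of the linear vector fields.\<close>

lemma along_commutator:
  assumes J: "orthogonal_complex_structure J" and I: "orthogonal_complex_structure I"
    and f: "smooth_on_sphere f" and x: "norm x = 1"
  obtains D where "linear D" "\<And>K. orthogonal_complex_structure K \<Longrightarrow> along K f x = D (K x)"
    "along I (along J f) x - along J (along I f) x = D (J (I x)) - D (I (J x))"
proof -
  obtain U F where U: "open U" "x \<in> U" "\<forall>k. Ck_on k U F" "\<forall>x\<in>U \<inter> sphere 0 1. F x = f x"
    using f x unfolding smooth_on_sphere_def by (metis mem_sphere_0)
  have F2: "Ck_on (Suc (Suc 0)) U F" using U(3) by blast
  have F1: "F differentiable (at y)" if "y \<in> U" for y using F2 that by simp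
  have along1: "along K f y = frechet_derivative F (at y) (K y)"
    if "y \<in> U" "norm y = 1" "orthogonal_complex_structure K" for K y
    using along_local[OF that(3) U(1) _ _ _ U(4)] F1 that by simp
  let ?H = "\<lambda>u v. \<Sum>b\<in>Basis. \<Sum>c\<in>Basis. (u \<bullet> b) * (v \<bullet> c) * frechet_derivative (\<lambda>y. frechet_derivative F (at y) b) (at x) c"
  have along2: "along K (along L f) x = frechet_derivative F (at x) (L (K x)) + ?H (L x) (K x)"
    if K: "orthogonal_complex_structure K" and L: "orthogonal_complex_structure L" for K L
  proof -
    let ?G = "\<lambda>x. \<Sum>b\<in>Basis. (L x \<bullet> b) * frechet_derivative F (at x) b"
    note dG = directional_has_derivative[OF bounded_linear_J[OF L] F2 U(2)]
    have "\<forall>y\<in>U \<inter> sphere 0 1. ?G y = along L f y"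
      using along1[OF _ _ L] frechet_derivative_basis[OF F1, of _ "L _"] by auto
    then have "along K (along L f) x = frechet_derivative ?G (at x) (K x)"
      using dG by (intro along_local[OF K U(1,2) _ x]) (auto simp: differentiable_def)
    also have "\<dots> = frechet_derivative F (at x) (L (K x))
        + (\<Sum>b\<in>Basis. (L x \<bullet> b) * frechet_derivative (\<lambda>y. frechet_derivative F (at y) b) (at x) (K x))"
      using frechet_derivative_at[OF dG, symmetric] by simp
    also have "(\<Sum>b\<in>Basis. (L x \<bullet> b) * frechet_derivative (\<lambda>y. frechet_derivative F (at y) b) (at x) (K x)) = ?H (L x) (K x)"
    proof (rule sum.cong[OF refl])
      fix b :: 'a assume b: "b \<in> Basis"
      have "(\<lambda>y. frechet_derivative F (at y) b) differentiable (at x)" using F2 b U(2) by simp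
      from frechet_derivative_basis[OF this, of "K x"]
      show "(L x \<bullet> b) * frechet_derivative (\<lambda>y. frechet_derivative F (at y) b) (at x) (K x)
        = (\<Sum>c\<in>Basis. (L x \<bullet> b) * (K x \<bullet> c) * frechet_derivative (\<lambda>y. frechet_derivative F (at y) b) (at x) c)"
        by (simp add: sum_distrib_left mult.assoc)
    qed
    finally show ?thesis .
  qed
  have "?H (J x) (I x) = (\<Sum>c\<in>Basis. \<Sum>b\<in>Basis. (J x \<bullet> b) * (I x \<bullet> c) * frechet_derivative (\<lambda>y. frechet_derivative F (at y) b) (at x) c)"
    by (rule sum.swap)
  also have "\<dots> = ?H (I x) (J x)"
    by (intro sum.cong refl) (simp add: symmetric_second_derivative[OF U(1,2) F2] mult.commute)
  finally have "along I (along J f) x - along J (along I f) x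
      = frechet_derivative F (at x) (J (I x)) - frechet_derivative F (at x) (I (J x))"
    by (simp add: along2[OF I J] along2[OF J I])
  then show thesis
    using U(2) F1 along1 x by (intro that[of "frechet_derivative F (at x)"]) (auto intro: linear_frechet_derivative)
qed

section \<open>The quaternionic frame of the 3-sphere\<close>

text \<open>Multiplication by the three imaginary quaternion units. The Kaehler form is the pairing \<open>J1 u \<bullet> v\<close>.\<close>

definition J1 :: "real^4 \<Rightarrow> real^4" where "J1 u = vector [- (u$2), u$1, - (u$4), u$3]"
definition J2 :: "real^4 \<Rightarrow> real^4" where "J2 u = vector [- (u$3), u$4, u$1, - (u$2)]"
definition J3 :: "real^4 \<Rightarrow> real^4" where "J3 u = vector [- (u$4), - (u$3), u$2, u$1]"

lemma vector_4_nth [simp]: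
  "(vector [a, b, c, d] :: real^4) $ 1 = a" "(vector [a, b, c, d] :: real^4) $ 2 = b"
  "(vector [a, b, c, d] :: real^4) $ 3 = c" "(vector [a, b, c, d] :: real^4) $ 4 = d"
  by (simp_all add: vector_def)

lemma inner_real4: "(u :: real^4) \<bullet> v = u$1 * v$1 + u$2 * v$2 + u$3 * v$3 + u$4 * v$4"
  by (simp add: inner_vec_def sum_4)

lemma J_nth [simp]:
  "J1 u $ 1 = - (u$2)" "J1 u $ 2 = u$1" "J1 u $ 3 = - (u$4)" "J1 u $ 4 = u$3"
  "J2 u $ 1 = - (u$3)" "J2 u $ 2 = u$4" "J2 u $ 3 = u$1" "J2 u $ 4 = - (u$2)"
  "J3 u $ 1 = - (u$4)" "J3 u $ 2 = - (u$3)" "J3 u $ 3 = u$2" "J3 u $ 4 = u$1"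
  by (simp_all add: J1_def J2_def J3_def)

lemma J_structures [simp]:
  "orthogonal_complex_structure J1" "orthogonal_complex_structure J2" "orthogonal_complex_structure J3"
  unfolding orthogonal_complex_structure_def orthogonal_transformation_def
  by (auto intro!: linearI simp: vec_eq_iff forall_4 inner_real4)

lemma J_products: "J1 (J2 x) = J3 x" "J3 (J2 x) = - J1 x" "J2 (J3 x) = J1 x"
    "J1 (J3 x) = - J2 x" "J1 (J1 x) = - x"
  by (simp_all add: vec_eq_iff forall_4)

lemma quaternionic_frame:
  assumes "norm x = 1"
  shows "v = (v \<bullet> x) *\<^sub>R x + (v \<bullet> J1 x) *\<^sub>R J1 x + (v \<bullet> J2 x) *\<^sub>R J2 x + (v \<bullet> J3 x) *\<^sub>R J3 x"
proof -
  have "x$1 * x$1 + x$2 * x$2 + x$3 * x$3 + x$4 * x$4 = 1"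
    using assms by (simp add: norm_eq_sqrt_inner inner_real4)
  then show ?thesis
    by (simp add: vec_eq_iff forall_4 inner_real4) algebra
qed

lemma inner_frame:
  assumes "norm x = 1"
  shows "(a *\<^sub>R J1 x + b *\<^sub>R J2 x + c *\<^sub>R J3 x) \<bullet> (a' *\<^sub>R J1 x + b' *\<^sub>R J2 x + c' *\<^sub>R J3 x)
    = a * a' + b * b' + c * c'"
    and "kaehler_form (a *\<^sub>R J1 x + b *\<^sub>R J2 x + c *\<^sub>R J3 x) (a' *\<^sub>R J1 x + b' *\<^sub>R J2 x + c' *\<^sub>R J3 x)
    = b * c' - c * b'"
    and "(a *\<^sub>R J1 x + b *\<^sub>R J2 x + c *\<^sub>R J3 x) \<bullet> x = 0"
proof -
  have x: "x$1 * x$1 + x$2 * x$2 + x$3 * x$3 + x$4 * x$4 = 1"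
    using assms by (simp add: norm_eq_sqrt_inner inner_real4)
  show "(a *\<^sub>R J1 x + b *\<^sub>R J2 x + c *\<^sub>R J3 x) \<bullet> (a' *\<^sub>R J1 x + b' *\<^sub>R J2 x + c' *\<^sub>R J3 x)
    = a * a' + b * b' + c * c'"
    using x by (simp add: inner_real4) algebra
  show "kaehler_form (a *\<^sub>R J1 x + b *\<^sub>R J2 x + c *\<^sub>R J3 x) (a' *\<^sub>R J1 x + b' *\<^sub>R J2 x + c' *\<^sub>R J3 x)
    = b * c' - c * b'"
    using x by (simp add: kaehler_form_def) algebra
  show "(a *\<^sub>R J1 x + b *\<^sub>R J2 x + c *\<^sub>R J3 x) \<bullet> x = 0"
    by (simp add: inner_real4) algebra
qed

text \<open>A local extension \<open>F\<close> has in general a normal derivative \<open>DF(p)(p)\<close>. Subtracting a multiple of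
  \<open>y \<bullet> y - 1\<close>, which vanishes on the sphere, removes it and leaves a tangent vector. Uniqueness follows by
  differentiating along the three orbits through \<open>p\<close>.\<close>

lemma sphere_grad_frame:
  assumes f: "C1_on_sphere f" and p: "norm p = 1"
  shows "sphere_grad f p = along J1 f p *\<^sub>R J1 p + along J2 f p *\<^sub>R J2 p + along J3 f p *\<^sub>R J3 p"
    (is "_ = ?v")
  unfolding sphere_grad_def
proof (rule the_equality)
  obtain U F where U: "open U" "p \<in> U" "Ck_on 1 U F" "\<forall>x\<in>U \<inter> sphere 0 1. F x = f x"
    using f p unfolding C1_on_sphere_def by (metis mem_sphere_0)
  define D where "D = frechet_derivative F (at p)"
  have dF: "F differentiable (at p)" using U by simp
  then have D: "(F has_derivative D) (at p)" by (simp add: D_def frechet_derivative_works)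
  interpret D: linear D unfolding D_def by (rule linear_frechet_derivative[OF dF])
  have al: "along K f p = D (K p)" if "orthogonal_complex_structure K" for K
    unfolding D_def by (rule along_local[OF that U(1,2) dF p U(4)])
  have "((\<lambda>y. F y - D p * (y \<bullet> y - 1) / 2) has_derivative (\<lambda>w. D w - D p * (p \<bullet> w))) (at p)"
    by (auto intro!: derivative_eq_intros D simp: inner_commute algebra_simps)
  moreover have "D w - D p * (p \<bullet> w) = ?v \<bullet> w" for w
  proof -
    have "D w = D ((w \<bullet> p) *\<^sub>R p + (w \<bullet> J1 p) *\<^sub>R J1 p + (w \<bullet> J2 p) *\<^sub>R J2 p + (w \<bullet> J3 p) *\<^sub>R J3 p)"
      using quaternionic_frame[OF p, of w] by simp
    then show ?thesis
      by (simp add: D.add D.scale al inner_add_left inner_commute algebra_simps)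
  qed
  ultimately have W: "((\<lambda>y. F y - D p * (y \<bullet> y - 1) / 2) has_derivative (\<lambda>w. ?v \<bullet> w)) (at p within sphere 0 1)"
    by (simp add: has_derivative_at_withinI)
  obtain r where r: "r > 0" "ball p r \<subseteq> U" using U(1,2) openE by blast
  have "(f has_derivative (\<lambda>w. ?v \<bullet> w)) (at p within sphere 0 1)"
  proof (rule has_derivative_transform_within[OF W r(1)])
    fix y assume y: "y \<in> sphere 0 1" "dist y p < r"
    then have "y \<bullet> y = 1" by (simp add: norm_eq_1)
    moreover have "F y = f y" using y U(4) r by (auto simp: dist_commute subset_iff)
    ultimately show "F y - D p * (y \<bullet> y - 1) / 2 = f y" by simp
  qed (use r p in auto)
  then show "?v \<bullet> p = 0 \<and> (f has_derivative (\<lambda>w. ?v \<bullet> w)) (at p within sphere 0 1)"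
    by (simp add: inner_frame(3)[OF p])
next
  fix v assume v: "v \<bullet> p = 0 \<and> (f has_derivative (\<lambda>w. v \<bullet> w)) (at p within sphere 0 1)"
  have "v \<bullet> J p = along J f p" if J: "orthogonal_complex_structure J" for J
  proof -
    have flow: "((\<lambda>t. flow J t p) has_derivative (\<lambda>s. s *\<^sub>R J p)) (at 0)"
      using has_vector_derivative_flow[OF J, of p 0] by (simp add: has_vector_derivative_def)
    have "(f has_derivative (\<lambda>w. v \<bullet> w)) (at (flow J 0 p) within range (\<lambda>t. flow J t p))"
      using v p norm_flow[OF J] by (auto intro: has_derivative_subset)
    from diff_chain_within[OF flow this]
    have "((\<lambda>t. f (flow J t p)) has_vector_derivative v \<bullet> J p) (at 0)"
      by (simp add: o_def has_vector_derivative_def)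
    then show ?thesis unfolding along_def by (rule vector_derivative_at[symmetric])
  qed
  then show "v = ?v" using quaternionic_frame[OF p, of v] v by simp
qed

lemma energy_and_kaehler_frame:
  assumes "C1_on_sphere f" "C1_on_sphere h" "norm x = 1"
  shows "(norm (sphere_grad f x))\<^sup>2 = (along J1 f x)\<^sup>2 + (along J2 f x)\<^sup>2 + (along J3 f x)\<^sup>2"
    and "kaehler_form (sphere_grad f x) (sphere_grad h x)
      = along J2 f x * along J3 h x - along J3 f x * along J2 h x"
  unfolding sphere_grad_frame[OF assms(1,3)] sphere_grad_frame[OF assms(2,3)] power2_norm_eq_inner
    inner_frame[OF assms(3)] by (simp_all add: power2_eq_square)

text \<open>Averaging over the orbits turns the integral into that of a derivative over a full period.\<close>

lemma sphere_integral_along: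
  fixes g :: "real^4 \<Rightarrow> real"
  assumes J: "orthogonal_complex_structure J"
    and d: "\<And>x t. norm x = 1 \<Longrightarrow> ((\<lambda>t. g (flow J t x)) has_real_derivative d (flow J t x)) (at t)"
    and cont: "continuous_on (sphere 0 1) d"
  shows "(LINT x|sphere_measure. d x) = 0"
proof -
  have "2 * pi * (LINT x|sphere_measure. d x) = (LINT x|sphere_measure. integral {0..2 * pi} (\<lambda>t. d (flow J t x)))"
    by (rule sphere_integral_orbit_average[symmetric])
       (use J cont in \<open>auto intro: orthogonal_transformation_flow continuous_on_flow\<close>)
  also have "\<dots> = (LINT (x::real^4)|sphere_measure. (0 :: real))"
  proof (rule Bochner_Integration.integral_cong)
    fix x :: "real^4" assume "x \<in> space sphere_measure"
    then have x: "norm x = 1" by simp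
    have "((\<lambda>t. d (flow J t x)) has_integral g (flow J (2 * pi) x) - g (flow J 0 x)) {0..2 * pi}"
      by (rule fundamental_theorem_of_calculus)
         (use d[OF x] in \<open>auto simp: has_real_derivative_iff_has_vector_derivative intro: has_vector_derivative_at_within\<close>)
    then show "integral {0..2 * pi} (\<lambda>t. d (flow J t x)) = 0"
      using flow_2pi[of J 0 x] by (simp add: integral_unique)
  qed simp
  finally show ?thesis by simp
qed

lemma sphere_integration_by_parts:
  fixes f g :: "real^4 \<Rightarrow> real"
  assumes J: "orthogonal_complex_structure J" and f: "C1_on_sphere f" and g: "C1_on_sphere g"
  shows "(LINT x|sphere_measure. along J f x * g x) = - (LINT x|sphere_measure. f x * along J g x)"
proof -
  note cont = C1_on_sphere_continuous[OF f] C1_on_sphere_continuous[OF g]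
    C1_on_sphere_continuous_along[OF J f] C1_on_sphere_continuous_along[OF J g]
  have "(LINT x|sphere_measure. along J f x * g x + f x * along J g x) = 0"
  proof (rule sphere_integral_along[OF J, of "\<lambda>x. f x * g x"])
    fix x :: "real^4" and t assume "norm x = 1"
    from DERIV_mult[OF C1_on_sphere_derivative[OF J f this] C1_on_sphere_derivative[OF J g this], of t]
    show "((\<lambda>t. f (flow J t x) * g (flow J t x)) has_real_derivative
        along J f (flow J t x) * g (flow J t x) + f (flow J t x) * along J g (flow J t x)) (at t)"
      by (simp add: add.commute mult.commute)
  qed (intro continuous_intros cont)
  moreover have "(LINT x|sphere_measure. along J f x * g x + f x * along J g x)
    = (LINT x|sphere_measure. along J f x * g x) + (LINT x|sphere_measure. f x * along J g x)"
    by (intro Bochner_Integration.integral_add integrable_sphere_measure continuous_intros cont)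
  ultimately show ?thesis by simp
qed

text \<open>Moving the derivatives from \<open>f\<close> to \<open>h\<close> produces the commutator \<open>[X\<^sub>3, X\<^sub>2] h = 2 X\<^sub>1 h\<close>, hence \<open>2 \<integral> f X\<^sub>1 h\<close>;
  one half of it is integrated by parts once more to obtain the antisymmetric expression.\<close>

lemma kaehler_integral:
  assumes f: "smooth_on_sphere f" and h: "smooth_on_sphere h"
  shows "(LINT x|sphere_measure. kaehler_form (sphere_grad f x) (sphere_grad h x))
    = (LINT x|sphere_measure. f x * along J1 h x - h x * along J1 f x)"
proof -
  note C1 = smooth_on_sphere_imp_C1[OF f] smooth_on_sphere_imp_C1[OF h]
    smooth_on_sphere_along_C1[OF _ h]
  note cont = C1[THEN C1_on_sphere_continuous] C1(1,2)[THEN C1_on_sphere_continuous_along[rotated]]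
    C1(3)[THEN C1_on_sphere_continuous_along[rotated]]
  have comm: "along J2 (along J3 h) x - along J3 (along J2 h) x = - 2 * along J1 h x" if x: "norm x = 1" for x
  proof (rule along_commutator[OF J_structures(3,2) h x])
    fix D assume "linear D" "\<And>K. orthogonal_complex_structure K \<Longrightarrow> along K h x = D (K x)"
      "along J2 (along J3 h) x - along J3 (along J2 h) x = D (J3 (J2 x)) - D (J2 (J3 x))"
    then show ?thesis by (simp add: J_products linear_neg)
  qed
  have "(LINT x|sphere_measure. kaehler_form (sphere_grad f x) (sphere_grad h x))
      = (LINT x|sphere_measure. along J2 f x * along J3 h x - along J3 f x * along J2 h x)"
    by (rule Bochner_Integration.integral_cong) (simp_all add: energy_and_kaehler_frame(2) C1)
  also have "\<dots> = (LINT x|sphere_measure. along J2 f x * along J3 h x) - (LINT x|sphere_measure. along J3 f x * along J2 h x)"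
    by (intro Bochner_Integration.integral_diff integrable_sphere_measure continuous_intros cont) simp_all
  also have "\<dots> = (LINT x|sphere_measure. f x * along J3 (along J2 h) x) - (LINT x|sphere_measure. f x * along J2 (along J3 h) x)"
    by (simp add: sphere_integration_by_parts C1)
  also have "\<dots> = (LINT x|sphere_measure. f x * along J3 (along J2 h) x - f x * along J2 (along J3 h) x)"
    by (intro Bochner_Integration.integral_diff[symmetric] integrable_sphere_measure continuous_intros cont) simp_all
  also have "\<dots> = (LINT x|sphere_measure. f x * along J1 h x + f x * along J1 h x)"
  proof (rule Bochner_Integration.integral_cong)
    fix x :: "real^4" assume "x \<in> space sphere_measure"
    then have "along J3 (along J2 h) x - along J2 (along J3 h) x = 2 * along J1 h x" using comm[of x] by simp
    then show "f x * along J3 (along J2 h) x - f x * along J2 (along J3 h) x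
        = f x * along J1 h x + f x * along J1 h x"
      by (simp flip: right_diff_distrib)
  qed simp
  also have "\<dots> = (LINT x|sphere_measure. f x * along J1 h x) + (LINT x|sphere_measure. f x * along J1 h x)"
    by (intro Bochner_Integration.integral_add integrable_sphere_measure continuous_intros cont) simp_all
  also have "\<dots> = (LINT x|sphere_measure. f x * along J1 h x) - (LINT x|sphere_measure. along J1 f x * h x)"
    using sphere_integration_by_parts[OF J_structures(1) C1(1,2)] by simp
  also have "\<dots> = (LINT x|sphere_measure. f x * along J1 h x - along J1 f x * h x)"
    by (intro Bochner_Integration.integral_diff[symmetric] integrable_sphere_measure continuous_intros cont) simp_all
  finally show ?thesis by (simp add: mult.commute)
qed

text \<open>The orbits of \<open>J1\<close> are the Hopf fibres. On each of them the inequality for loops applies, and since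
  the fibre integrals depend continuously on the fibre, they all vanish if their mean does.\<close>

lemma hopf_fibre_integral:
  assumes f: "C1_on_sphere f" and h: "C1_on_sphere h"
  defines "q \<equiv> \<lambda>x. (along J1 f x)\<^sup>2 + (along J1 h x)\<^sup>2 + f x * along J1 h x - h x * along J1 f x"
  shows "0 \<le> (LINT x|sphere_measure. q x)"
    and "(LINT x|sphere_measure. q x) = 0 \<Longrightarrow> norm x = 1 \<Longrightarrow>
      \<exists>\<alpha> \<beta>. \<forall>t. Complex (f (flow J1 t x)) (- h (flow J1 t x)) = \<alpha> + \<beta> * cis t"
proof -
  note cont = C1_on_sphere_continuous[OF f] C1_on_sphere_continuous[OF h]
    C1_on_sphere_continuous_along[OF J_structures(1) f] C1_on_sphere_continuous_along[OF J_structures(1) h]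
  have q: "continuous_on (sphere 0 1) q" unfolding q_def by (intro continuous_intros cont)
  have orbit: "continuous_on UNIV (\<lambda>t. u (flow J1 t x))" if "continuous_on (sphere 0 1) u" "norm x = 1" for u :: "real^4 \<Rightarrow> real" and x
    by (rule continuous_on_compose2[OF that(1)], unfold flow_def, intro continuous_intros)
       (use norm_flow[OF J_structures(1), of _ x] that in \<open>auto simp: flow_def\<close>)
  have "continuous_on (sphere 0 1 \<times> cbox 0 (2 * pi)) (\<lambda>(x, t). q (flow J1 t x))"
    using continuous_on_compose2[OF q continuous_on_flow[OF J_structures(1)],
        of "sphere 0 1 \<times> cbox 0 (2 * pi)"]
    by (simp add: case_prod_beta image_subset_iff)
  then have A: "continuous_on (sphere 0 1) (\<lambda>x. integral {0..2 * pi} (\<lambda>t. q (flow J1 t x)))"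
    using integral_continuous_on_param[of "sphere 0 1" 0 "2 * pi" "\<lambda>x t. q (flow J1 t x)"] by simp
  have avg: "(LINT x|sphere_measure. integral {0..2 * pi} (\<lambda>t. q (flow J1 t x))) = 2 * pi * (LINT x|sphere_measure. q x)"
    by (rule sphere_integral_orbit_average)
       (use q in \<open>auto intro: orthogonal_transformation_flow continuous_on_flow\<close>)
  note loop = loop_inequality[OF C1_on_sphere_derivative[OF J_structures(1) f] C1_on_sphere_derivative[OF J_structures(1) h]
     orbit[OF cont(3)] orbit[OF cont(4)], unfolded flow_2pi, OF _ _ _ _ refl refl refl refl]
  have nonneg: "0 \<le> integral {0..2 * pi} (\<lambda>t. q (flow J1 t x))" if "norm x = 1" for x
    using loop(1)[OF that that that that] by (simp add: q_def)
  have "0 \<le> (LINT x|sphere_measure. integral {0..2 * pi} (\<lambda>t. q (flow J1 t x)))"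
    by (rule integral_nonneg_AE, rule AE_I2) (use nonneg in auto)
  from divide_nonneg_pos[OF this, of "2 * pi"]
  show "0 \<le> (LINT x|sphere_measure. q x)" by (simp add: avg)
  assume "(LINT x|sphere_measure. q x) = 0" and x: "norm x = 1"
  then have "integral {0..2 * pi} (\<lambda>t. q (flow J1 t x)) = 0"
    by (intro sphere_integral_nonneg_eq_0[OF A nonneg]) (simp_all add: avg)
  then show "\<exists>\<alpha> \<beta>. \<forall>t. Complex (f (flow J1 t x)) (- h (flow J1 t x)) = \<alpha> + \<beta> * cis t"
    using loop(2)[OF x x x x] by (simp add: q_def)
qed

section \<open>Tangential Cauchy-Riemann functions are polynomials\<close>

text \<open>The complex coordinates of \<open>\<real>\<^sup>4 = \<complex>\<^sup>2\<close> for which \<open>J1\<close> is multiplication by \<open>\<i>\<close>.\<close>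

definition coord1 :: "real^4 \<Rightarrow> complex" where "coord1 x = Complex (x$1) (x$2)"
definition coord2 :: "real^4 \<Rightarrow> complex" where "coord2 x = Complex (x$3) (x$4)"

lemma coord_linear: "linear coord1" "linear coord2"
  by (auto intro!: linearI simp: coord1_def coord2_def complex_eq_iff)

lemma coord_J1: "coord1 (J1 x) = \<i> * coord1 x" "coord2 (J1 x) = \<i> * coord2 x"
  by (simp_all add: coord1_def coord2_def complex_eq_iff)

lemma coord_flow: "coord1 (flow J1 t x) = cis t * coord1 x" "coord2 (flow J1 t x) = cis t * coord2 x"
  by (simp_all add: coord1_def coord2_def complex_eq_iff flow_def)

lemma coord_eqI: "coord1 x = coord1 y \<Longrightarrow> coord2 x = coord2 y \<Longrightarrow> x = y"
  by (simp add: coord1_def coord2_def vec_eq_iff forall_4)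

lemma continuous_on_coord: "continuous_on X coord1" "continuous_on X coord2"
  using coord_linear by (auto intro: linear_continuous_on simp: linear_linear)

lemma flow_neg: "orthogonal_complex_structure J \<Longrightarrow> flow J t (- x) = - flow J t x"
  using flow_scaleR[of J t "-1" x] by simp

lemma sgn_flow: "orthogonal_complex_structure J \<Longrightarrow> sgn (flow J t x) = flow J t (sgn x)"
  by (simp add: sgn_div_norm flow_scaleR)

lemma differentiable_sgn:
  fixes x :: "'a::euclidean_space"
  assumes "x \<noteq> 0"
  shows "sgn differentiable (at x)"
proof -
  have "(\<lambda>y. inverse (norm y) *\<^sub>R y) differentiable (at x)"
    using assms by (intro differentiable_scaleR differentiable_inverse differentiable_ident)
      (auto intro: differentiable_norm_at)
  then show ?thesis by (simp add: sgn_div_norm[abs_def])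
qed

text \<open>The extension \<open>G\<close> of \<open>H\<close>, homogeneous of degree \<open>k\<close>, has a complex linear differential: on the
  complex line through \<open>x\<close> by Euler's relation and the weight, on the orthogonal complex line, spanned by \<open>J2 x\<close>,
  by the Cauchy-Riemann equation. Its restriction \<open>g\<close> to the line \<open>(z, 1)\<close> is therefore entire, and for \<open>\<bar>z\<bar> \<ge> 1\<close> it is bounded by
  a multiple of \<open>\<bar>z\<bar>\<^sup>k\<close>, so it is a polynomial. A point with nonzero second coordinate \<open>w\<close> is \<open>w\<close> times
  a point of this line, and the remaining circle is reached by continuity.\<close>

lemma weighted_CR_imp_polynomial:
  fixes H :: "real^4 \<Rightarrow> complex"
  assumes diff: "\<And>x. x \<noteq> 0 \<Longrightarrow> (\<lambda>y. H (sgn y)) differentiable (at x)"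
    and weight: "\<And>x t. norm x = 1 \<Longrightarrow> H (flow J1 t x) = cis t ^ k * H x"
    and CR: "\<And>x. norm x = 1 \<Longrightarrow> along J3 H x = \<i> * along J2 H x"
  obtains c where "\<And>x. norm x = 1 \<Longrightarrow> H x = (\<Sum>j\<le>k. c j * coord1 x ^ j * coord2 x ^ (k - j))"
proof -
  define G where "G x = (norm x) ^ k *\<^sub>R H (sgn x)" for x
  have Gdiff: "G differentiable (at x)" if "x \<noteq> 0" for x
    unfolding G_def using that by (intro differentiable_scaleR differentiable_power diff differentiable_norm_at)
  have complex_linear: "frechet_derivative G (at x) (J1 v) = \<i> * frechet_derivative G (at x) v"
    if x: "x \<noteq> 0" for x v
  proof -
    define D where "D = frechet_derivative G (at x)"
    define s where "s = sgn x"
    have s: "norm s = 1" using x by (simp add: s_def norm_sgn)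
    interpret linear D unfolding D_def by (rule linear_frechet_derivative[OF Gdiff[OF x]])
    have chain: "((\<lambda>t. G (\<gamma> t)) has_vector_derivative D d) (at 0)"
      if "(\<gamma> has_vector_derivative d) (at 0)" "\<gamma> 0 = x" for \<gamma> d
      using vector_derivative_diff_chain_within[OF that(1), of G D] Gdiff[OF x] that(2)
      by (auto simp: D_def frechet_derivative_works o_def intro: has_derivative_at_withinI)
    have DJ: "D (J x) = norm x ^ k *\<^sub>R along J H s" if J: "orthogonal_complex_structure J" for J
    proof -
      have "H (flow J t s) = inverse (norm x ^ k) *\<^sub>R G (flow J t x)" for t
        using x by (simp add: G_def s_def sgn_flow[OF J] norm_flow[OF J])
      moreover have "((\<lambda>t. inverse (norm x ^ k) *\<^sub>R G (flow J t x)) has_vector_derivative inverse (norm x ^ k) *\<^sub>R D (J x)) (at 0)"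
        using has_vector_derivative_flow[OF J, of x 0]
        by (intro bounded_linear.has_vector_derivative[OF bounded_linear_scaleR_right] chain) simp_all
      ultimately have "along J H s = inverse (norm x ^ k) *\<^sub>R D (J x)"
        unfolding along_def by (simp add: vector_derivative_at)
      then show ?thesis using x by simp
    qed
    have radial: "D x = of_nat k * G x"
    proof -
      have "((\<lambda>t. (1 + t) *\<^sub>R x) has_vector_derivative x) (at 0)"
        by (auto intro!: derivative_eq_intros)
      then have "((\<lambda>t. G ((1 + t) *\<^sub>R x)) has_vector_derivative D x) (at 0)"
        by (rule chain) simp
      moreover have "((\<lambda>t. G ((1 + t) *\<^sub>R x)) has_vector_derivative (of_nat k * G x)) (at 0)"
      proof (rule has_vector_derivative_transform_within_open)
        have "((\<lambda>t. (1 + t) ^ k) has_real_derivative real k) (at 0)"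
          by (auto intro!: derivative_eq_intros)
        from has_vector_derivative_scaleR[OF this has_vector_derivative_const, of "G x"]
        have "((\<lambda>t. (1 + t) ^ k *\<^sub>R G x) has_vector_derivative real k *\<^sub>R G x) (at 0)" by simp
        moreover have "real k *\<^sub>R G x = of_nat k * G x" by (simp add: scaleR_conv_of_real)
        ultimately show "((\<lambda>t. (1 + t) ^ k *\<^sub>R G x) has_vector_derivative of_nat k * G x) (at 0)" by metis
        show "(1 + t) ^ k *\<^sub>R G x = G ((1 + t) *\<^sub>R x)" if "t \<in> {-1<..}" for t
          using that by (simp add: G_def sgn_scaleR power_mult_distrib)
      qed auto
      ultimately show ?thesis by (rule vector_derivative_unique_at)
    qed
    have "((\<lambda>t. H (flow J1 t s)) has_vector_derivative (\<i> * of_nat k) * H s) (at 0)"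
    proof -
      have "((\<lambda>z. exp (\<i> * of_nat k * z) * H s) has_field_derivative (\<i> * of_nat k) * H s) (at (of_real 0))"
        by (auto intro!: derivative_eq_intros)
      then have "((\<lambda>t. exp (\<i> * of_nat k * of_real t) * H s) has_vector_derivative (\<i> * of_nat k) * H s) (at 0)"
        by (rule has_vector_derivative_real_field)
      moreover have "exp (\<i> * of_nat k * of_real t) = cis t ^ k" for t
        by (simp only: cis_conv_exp exp_of_nat_mult[symmetric] mult_ac)
      ultimately show ?thesis using weight[OF s] by simp
    qed
    then have "along J1 H s = \<i> * of_nat k * H s"
      unfolding along_def by (rule vector_derivative_at)
    then have e1: "D (J1 x) = \<i> * D x"
      by (simp add: DJ radial G_def s_def)
    have e2: "D (J3 x) = \<i> * D (J2 x)"
      by (simp add: DJ CR[OF s])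
    have sx: "s = inverse (norm x) *\<^sub>R x" by (simp add: s_def sgn_div_norm)
    have Jscale: "J1 (r *\<^sub>R y) = r *\<^sub>R J1 y" "J2 (r *\<^sub>R y) = r *\<^sub>R J2 y" "J3 (r *\<^sub>R y) = r *\<^sub>R J3 y" 
        "J1 (y + z) = J1 y + J1 z" for r y z
      by (simp_all add: vec_eq_iff forall_4)
    have e1: "D (J1 s) = \<i> * D s"
      unfolding sx Jscale scale e1 by (simp only: mult_scaleR_right)
    have e2: "D (J3 s) = \<i> * D (J2 s)"
      unfolding sx Jscale scale e2 by (simp only: mult_scaleR_right)
    define V where "V = (v \<bullet> s) *\<^sub>R s + (v \<bullet> J1 s) *\<^sub>R J1 s + (v \<bullet> J2 s) *\<^sub>R J2 s + (v \<bullet> J3 s) *\<^sub>R J3 s"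
    have V: "v = V" unfolding V_def by (rule quaternionic_frame[OF s])
    have "D (J1 V) = \<i> * D V"
      unfolding V_def Jscale J_products add scale neg e1 e2 by (simp add: scaleR_conv_of_real algebra_simps)
    then have "D (J1 v) = \<i> * D v" unfolding V[symmetric] .
    then show ?thesis by (simp add: D_def)
  qed
  define e :: "complex \<Rightarrow> real^4" where "e z = vector [Re z, Im z, 1, 0]" for z
  define e1 :: "real^4" where "e1 = vector [1, 0, 0, 0]"
  have e0: "e z \<noteq> 0" for z by (simp add: e_def vec_eq_iff forall_4)
  define g where "g z = G (e z)" for z
  have "(g has_field_derivative frechet_derivative G (at (e z)) e1) (at z)" for z
  proof -
    interpret linear "frechet_derivative G (at (e z))" by (rule linear_frechet_derivative[OF Gdiff[OF e0]])
    have e_affine: "e z = Re z *\<^sub>R e1 + Im z *\<^sub>R J1 e1 + vector [0, 0, 1, 0]" for z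
      by (simp add: vec_eq_iff forall_4 e_def e1_def)
    have "(e has_derivative (\<lambda>v. Re v *\<^sub>R e1 + Im v *\<^sub>R J1 e1)) (at z)"
      unfolding e_affine[abs_def] by (auto intro!: derivative_eq_intros)
    from has_derivative_compose[OF this Gdiff[OF e0, unfolded frechet_derivative_works]]
    have "(g has_derivative (\<lambda>v. frechet_derivative G (at (e z)) (Re v *\<^sub>R e1 + Im v *\<^sub>R J1 e1))) (at z)"
      unfolding g_def .
    moreover have "frechet_derivative G (at (e z)) (Re v *\<^sub>R e1 + Im v *\<^sub>R J1 e1) = frechet_derivative G (at (e z)) e1 * v" for v
    proof -
      have "frechet_derivative G (at (e z)) (Re v *\<^sub>R e1 + Im v *\<^sub>R J1 e1)
          = (of_real (Re v) + \<i> * of_real (Im v)) * frechet_derivative G (at (e z)) e1"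
        unfolding add scale complex_linear[OF e0] by (simp add: scaleR_conv_of_real algebra_simps)
      then show ?thesis by (simp flip: complex_eq)
    qed
    ultimately show ?thesis by (simp add: has_field_derivative_def)
  qed
  then have holo: "g holomorphic_on UNIV" by (auto simp: holomorphic_on_open)
  have Hcont: "continuous_on (sphere 0 1) H"
  proof -
    have "continuous_on (sphere 0 1) (\<lambda>y. H (sgn y))"
      by (intro continuous_at_imp_continuous_on ballI differentiable_imp_continuous_within diff) auto
    then show ?thesis by (rule continuous_on_eq) (simp add: sgn_div_norm)
  qed
  then have "bounded (H ` sphere 0 1)"
    by (intro compact_imp_bounded compact_continuous_image) simp_all
  then obtain B where B: "\<And>x. norm x = 1 \<Longrightarrow> norm (H x) \<le> B"
    unfolding bounded_iff by (metis imageI mem_sphere_0)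
  have "norm (g z) \<le> (B * 2 ^ k) * norm z ^ k" if "1 \<le> norm z" for z
  proof -
    have "(norm (e z))\<^sup>2 = (norm z)\<^sup>2 + 1"
      unfolding power2_norm_eq_inner[of "e z"] cmod_power2
      by (simp add: inner_real4 e_def power2_eq_square)
    also have "\<dots> \<le> (2 * norm z)\<^sup>2"
      using that one_le_power[OF that, of 2] by (simp add: power2_eq_square)
    finally have "norm (e z) \<le> 2 * norm z" by (rule power2_le_imp_le) simp
    then have "norm (e z) ^ k \<le> (2 * norm z) ^ k" by (rule power_mono) simp
    moreover have "norm (H (sgn (e z))) \<le> B" using e0 by (intro B) (simp add: norm_sgn)
    ultimately have "norm (e z) ^ k * norm (H (sgn (e z))) \<le> (2 * norm z) ^ k * B"
      by (intro mult_mono) simp_all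
    then show ?thesis by (simp add: g_def G_def power_mult_distrib mult_ac)
  qed
  from Liouville_polynomial[OF holo this]
  obtain c where c: "\<And>z. g z = (\<Sum>j\<le>k. c j * z ^ j)" by metis
  let ?p = "\<lambda>x. \<Sum>j\<le>k. c j * coord1 x ^ j * coord2 x ^ (k - j)"
  have generic: "H x = ?p x" if x: "norm x = 1" and w: "coord2 x \<noteq> 0" for x
  proof -
    define w where "w = coord2 x"
    define \<rho> \<theta> where "\<rho> = norm w" and "\<theta> = Arg w"
    define y where "y = \<rho> *\<^sub>R e (coord1 x / w)"
    have w_polar: "w = of_real \<rho> * cis \<theta>"
      using rcis_cmod_Arg[of w] by (simp add: rcis_def \<rho>_def \<theta>_def)
    have \<rho>: "\<rho> > 0" using w by (simp add: \<rho>_def w_def)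
    have "x = flow J1 \<theta> y"
    proof (rule coord_eqI)
      have "coord1 (e q) = q" "coord2 (e q) = 1" for q
        by (simp_all add: coord1_def coord2_def e_def complex_eq_iff)
      then have "coord1 y = of_real \<rho> * (coord1 x / w)" "coord2 y = of_real \<rho>"
        unfolding y_def linear_scale[OF coord_linear(1)] linear_scale[OF coord_linear(2)]
        by (simp_all add: scaleR_conv_of_real)
      moreover have "cis \<theta> * of_real \<rho> = w" by (subst w_polar) (rule mult.commute)
      ultimately have "coord1 (flow J1 \<theta> y) = w * (coord1 x / w)" "coord2 (flow J1 \<theta> y) = w"
        by (simp_all only: coord_flow mult.assoc[symmetric])
      then show "coord1 x = coord1 (flow J1 \<theta> y)" "coord2 x = coord2 (flow J1 \<theta> y)"
        using w by (simp_all add: w_def)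
    qed
    then have y: "norm y = 1" and Hx: "H x = cis \<theta> ^ k * H y"
      using x weight[of y \<theta>] norm_flow[OF J_structures(1), of \<theta> y] by simp_all
    have ne: "norm (e (coord1 x / w)) = inverse \<rho>" using y \<rho> by (simp add: y_def field_simps)
    have "sgn (e (coord1 x / w)) = y" by (simp add: sgn_div_norm ne y_def)
    then have "g (coord1 x / w) = of_real (inverse \<rho> ^ k) * H y"
      by (simp add: g_def G_def ne scaleR_conv_of_real)
    then have "H x = w ^ k * g (coord1 x / w)"
      using \<rho> by (simp add: Hx w_polar power_mult_distrib field_simps)
    also have "\<dots> = (\<Sum>j\<le>k. w ^ k * (c j * (coord1 x / w) ^ j))" by (simp add: c sum_distrib_left)
    also have "\<dots> = ?p x"
      by (rule sum.cong) (use w in \<open>auto simp: w_def power_divide power_diff mult_ac\<close>)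
    finally show ?thesis .
  qed
  \<comment> \<open>Points on the circle \<open>w = 0\<close> are approached along the orbit of \<open>J2\<close>, which leaves it at once.\<close>
  have "H x = ?p x" if x: "norm x = 1" for x
  proof (cases "coord2 x = 0")
    case True
    have pcont: "continuous_on X ?p" for X by (intro continuous_intros continuous_on_coord)
    have flow: "continuous_on UNIV (\<lambda>t. flow J2 t x)" unfolding flow_def by (intro continuous_intros)
    have "continuous_on UNIV (\<lambda>t. H (flow J2 t x))" "continuous_on UNIV (\<lambda>t. ?p (flow J2 t x))"
      by (rule continuous_on_compose2[OF Hcont flow], use x in \<open>auto simp: norm_flow\<close>)
         (rule continuous_on_compose2[OF pcont flow], auto)
    then have lim: "((\<lambda>t. H (flow J2 t x)) \<longlongrightarrow> H x) (at 0)" "((\<lambda>t. ?p (flow J2 t x)) \<longlongrightarrow> ?p x) (at 0)"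
      by (auto simp: continuous_on_eq_continuous_at continuous_at dest: spec[of _ 0])
    have "H (flow J2 t x) = ?p (flow J2 t x)" if "t \<noteq> 0" "dist t 0 < pi" for t
    proof (rule generic)
      have "sin t \<noteq> 0" using that sin_gt_zero[of t] sin_gt_zero[of "- t"] by (cases "t > 0") auto
      moreover have "x$1 \<noteq> 0 \<or> x$2 \<noteq> 0"
        using True x by (auto simp: coord2_def complex_eq_iff norm_eq_sqrt_inner inner_real4)
      ultimately show "coord2 (flow J2 t x) \<noteq> 0"
        using True by (auto simp: coord2_def flow_def complex_eq_iff)
    qed (simp add: norm_flow x)
    then have "eventually (\<lambda>t. H (flow J2 t x) = ?p (flow J2 t x)) (at 0)"
      unfolding eventually_at by (intro exI[of _ pi]) auto
    from Lim_transform_eventually[OF lim(1) this] lim(2) show ?thesis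
      by (intro tendsto_unique[OF at_neq_bot])
  qed (use generic x in blast)
  then show thesis by (rule that)
qed

section \<open>The extremal pairs\<close>

lemma C1_on_sphere_sgn_differentiable:
  assumes f: "C1_on_sphere f" and x: "x \<noteq> 0"
  shows "(\<lambda>y. f (sgn y)) differentiable (at x)"
proof -
  have "norm (sgn x) = 1" using x by (simp add: norm_sgn)
  then obtain U F where U: "open U" "sgn x \<in> U" "Ck_on 1 U F" "\<forall>x\<in>U \<inter> sphere 0 1. F x = f x"
    using f unfolding C1_on_sphere_def by (metis mem_sphere_0)
  have "F differentiable (at (sgn x))" using U by simp
  then have "(F \<circ> sgn) differentiable (at x)"
    using differentiable_sgn[OF x] by (intro differentiable_chain_at)
  then obtain D where D: "((F \<circ> sgn) has_derivative D) (at x)" by (auto simp: differentiable_def)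
  have "open (sgn -` U \<inter> - {0})"
    using continuous_open_preimage[of "- {0}" sgn U] U(1)
    by (simp add: Int_commute continuous_on_sgn open_Compl)
  then have "((\<lambda>y. f (sgn y)) has_derivative D) (at x)"
    by (rule has_derivative_transform_within_open[OF D]) (use U x in \<open>auto simp: norm_sgn\<close>)
  then show ?thesis by (auto simp: differentiable_def)
qed

lemma along_affine:
  fixes f :: "real^4 \<Rightarrow> real"
  assumes J: "orthogonal_complex_structure J" and f: "C1_on_sphere f" and x: "norm x = 1"
  shows "along J (\<lambda>x. a + c * f x) x = c * along J f x"
proof -
  have "((\<lambda>t. a + c * f (flow J t x)) has_real_derivative c * along J f x) (at 0)"
    using C1_on_sphere_derivative[OF J f x, of 0] by (auto intro!: derivative_eq_intros)
  then show ?thesis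
    unfolding along_def has_real_derivative_iff_has_vector_derivative by (rule vector_derivative_at)
qed

lemma along_complex:
  assumes J: "orthogonal_complex_structure J" and f: "C1_on_sphere f" and h: "C1_on_sphere h" and x: "norm x = 1"
  shows "((\<lambda>t. Complex (f (flow J t x)) (- h (flow J t x))) has_vector_derivative
      Complex (along J f x) (- along J h x)) (at 0)"
    and "along J (\<lambda>x. Complex (f x) (- h x)) x = Complex (along J f x) (- along J h x)"
proof -
  show *: "((\<lambda>t. Complex (f (flow J t x)) (- h (flow J t x))) has_vector_derivative
      Complex (along J f x) (- along J h x)) (at 0)"
    using C1_on_sphere_derivative[OF J f x, of 0] C1_on_sphere_derivative[OF J h x, of 0]
    by (auto simp: has_vector_derivative_complex_iff intro!: derivative_eq_intros)
  then show "along J (\<lambda>x. Complex (f x) (- h x)) x = Complex (along J f x) (- along J h x)"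
    unfolding along_def by (rule vector_derivative_at)
qed

text \<open>The relations between the coefficients say that \<open>f - \<i> h\<close> is complex linear, with coefficients
  \<open>\<mu>\<^sub>1 - \<i> \<mu>\<^sub>2\<close> and \<open>\<mu>\<^sub>3 - \<i> \<mu>\<^sub>4\<close>.\<close>

lemma extremal_pair_iff_complex_linear:
  "extremal_pair f h \<longleftrightarrow>
    (\<exists>\<alpha> \<beta>. \<forall>x. norm x = 1 \<longrightarrow> Complex (f x) (- h x) = \<alpha> * coord1 x + \<beta> * coord2 x)"
proof
  assume "extremal_pair f h"
  then obtain \<mu> \<sigma> :: "4 \<Rightarrow> real" where "\<forall>x\<in>sphere 0 1. f x = (\<Sum>i\<in>UNIV. \<mu> i * x$i)"
    "\<forall>x\<in>sphere 0 1. h x = (\<Sum>i\<in>UNIV. \<sigma> i * x$i)"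
    "\<sigma> 2 = - \<mu> 1" "\<sigma> 1 = \<mu> 2" "\<sigma> 4 = - \<mu> 3" "\<sigma> 3 = \<mu> 4"
    unfolding extremal_pair_def by blast
  then have "\<forall>x. norm x = 1 \<longrightarrow> Complex (f x) (- h x) = Complex (\<mu> 1) (- \<mu> 2) * coord1 x + Complex (\<mu> 3) (- \<mu> 4) * coord2 x"
    by (simp add: sum_4 coord1_def coord2_def complex_eq_iff)
  then show "\<exists>\<alpha> \<beta>. \<forall>x. norm x = 1 \<longrightarrow> Complex (f x) (- h x) = \<alpha> * coord1 x + \<beta> * coord2 x" by blast
next
  assume "\<exists>\<alpha> \<beta>. \<forall>x. norm x = 1 \<longrightarrow> Complex (f x) (- h x) = \<alpha> * coord1 x + \<beta> * coord2 x"
  then obtain \<alpha> \<beta> where *: "\<And>x. norm x = 1 \<Longrightarrow> Complex (f x) (- h x) = \<alpha> * coord1 x + \<beta> * coord2 x" by blast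
  define \<mu> :: "4 \<Rightarrow> real" where "\<mu> i = (if i = 1 then Re \<alpha> else if i = 2 then - Im \<alpha> else if i = 3 then Re \<beta> else - Im \<beta>)" for i
  define \<sigma> :: "4 \<Rightarrow> real" where "\<sigma> i = (if i = 1 then - Im \<alpha> else if i = 2 then - Re \<alpha> else if i = 3 then - Im \<beta> else - Re \<beta>)" for i
  have "\<forall>x\<in>sphere 0 1. f x = (\<Sum>i\<in>UNIV. \<mu> i * x$i)" "\<forall>x\<in>sphere 0 1. h x = (\<Sum>i\<in>UNIV. \<sigma> i * x$i)"
    using arg_cong[OF *, of _ Re] arg_cong[OF *, of _ "\<lambda>z. - Im z"]
    by (simp_all add: sum_4 coord1_def coord2_def \<mu>_def \<sigma>_def)
  moreover have "\<sigma> 2 = - \<mu> 1" "\<sigma> 1 = \<mu> 2" "\<sigma> 4 = - \<mu> 3" "\<sigma> 3 = \<mu> 4"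
    by (simp_all add: \<mu>_def \<sigma>_def)
  ultimately show "extremal_pair f h"
    unfolding extremal_pair_def first_eigenspace_def by blast
qed

text \<open>Rotation by \<open>\<pi>\<close> along the fibre is \<open>x \<mapsto> - x\<close>, so in \<open>\<alpha> + \<beta> cis t\<close> the two terms are the even and
  the odd part of the function. They have weight \<open>0\<close> and \<open>1\<close>, and both inherit the Cauchy-Riemann equation.\<close>

lemma CR_function_is_affine:
  assumes f: "C1_on_sphere f" and h: "C1_on_sphere h"
    and CR: "\<And>x. norm x = 1 \<Longrightarrow> along J2 f x = - along J3 h x \<and> along J3 f x = along J2 h x"
    and fibre: "\<And>x. norm x = 1 \<Longrightarrow> \<exists>\<alpha> \<beta>. \<forall>t. Complex (f (flow J1 t x)) (- h (flow J1 t x)) = \<alpha> + \<beta> * cis t"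
  shows "\<exists>a b. extremal_pair (\<lambda>x. f x - a) (\<lambda>x. h x - b)"
proof -
  define H where "H x = Complex (f x) (- h x)" for x
  \<comment> \<open>\<open>P 1\<close> is the even part and \<open>P (- 1)\<close> the odd part.\<close>
  define P where "P s x = (H x + s * H (- x)) / 2" for s x
  have H_alt: "H x = of_real (f x) - \<i> * of_real (h x)" for x
    by (simp add: H_def complex_eq_iff)
  have Hdiff: "(\<lambda>y. H (sgn y)) differentiable (at x)" if "x \<noteq> 0" for x
    unfolding H_alt using C1_on_sphere_sgn_differentiable[OF f that] C1_on_sphere_sgn_differentiable[OF h that]
    by (intro differentiable_diff differentiable_mult differentiable_const
        bounded_linear_imp_differentiable[OF bounded_linear_of_real, THEN differentiable_compose[of complex_of_real]])
       auto
  have Pdiff: "(\<lambda>y. P s (sgn y)) differentiable (at x)" if "x \<noteq> 0" for x s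
  proof -
    have "((\<lambda>y. H (sgn y)) \<circ> uminus) differentiable (at x)"
      using that by (intro differentiable_chain_at Hdiff differentiable_minus differentiable_ident) auto
    then have "(\<lambda>y. H (- sgn y)) differentiable (at x)" by (simp add: o_def sgn_minus)
    then show ?thesis
      unfolding P_def using Hdiff[OF that] by (intro differentiable_divide differentiable_add differentiable_mult) auto
  qed
  have alongP: "along J (P s) x = (along J H x + s * along J H (- x)) / 2"
    if J: "orthogonal_complex_structure J" and x: "norm x = 1" for J s x
  proof -
    have d: "((\<lambda>t. H (flow J t y)) has_vector_derivative along J H y) (at 0)" if "norm y = 1" for y
      using along_complex[OF J f h that] by (simp add: H_def[abs_def])
    have "((\<lambda>t. (H (flow J t x) + s * H (flow J t (- x))) / 2) has_vector_derivative (along J H x + s * along J H (- x)) / 2) (at 0)"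
      by (intro has_vector_derivative_divide has_vector_derivative_add has_vector_derivative_mult_right d) (use x in simp_all)
    then show ?thesis
      unfolding along_def[of J "P s"] P_def by (subst (asm) flow_neg[OF J]) (rule vector_derivative_at)
  qed
  have "along J3 H x = \<i> * along J2 H x" if "norm x = 1" for x
    using CR[OF that] along_complex(2)[OF _ f h that] by (simp add: H_def[abs_def] complex_eq_iff)
  then have CRP: "along J3 (P s) x = \<i> * along J2 (P s) x" if "norm x = 1" for s x
    using that by (simp add: alongP algebra_simps)
  have weights: "P 1 (flow J1 t x) = cis t ^ 0 * P 1 x \<and> P (- 1) (flow J1 t x) = cis t ^ 1 * P (- 1) x" if x: "norm x = 1" for x t
  proof -
    obtain \<alpha> \<beta> where *: "\<And>t. H (flow J1 t x) = \<alpha> + \<beta> * cis t"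
      using fibre[OF x] unfolding H_def by blast
    have "- flow J1 t x = flow J1 (pi + t) x" for t
      using flow_flow[OF J_structures(1), of pi t x] by (simp add: flow_pi)
    then have "H (- flow J1 t x) = \<alpha> - \<beta> * cis t" for t
      by (simp add: * cis_mult[symmetric])
    from this[of t] this[of 0] *[of t] *[of 0] show ?thesis
      by (simp add: P_def)
  qed
  obtain c where c: "\<And>x. norm x = 1 \<Longrightarrow> P 1 x = (\<Sum>j\<le>0. c j * coord1 x ^ j * coord2 x ^ (0 - j))"
    by (rule weighted_CR_imp_polynomial[of "P 1" 0]) (use Pdiff weights CRP in auto)
  obtain d where d: "\<And>x. norm x = 1 \<Longrightarrow> P (- 1) x = (\<Sum>j\<le>1. d j * coord1 x ^ j * coord2 x ^ (1 - j))"
    by (rule weighted_CR_imp_polynomial[of "P (- 1)" 1]) (use Pdiff weights CRP in auto)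
  have "H x = c 0 + (d 1 * coord1 x + d 0 * coord2 x)" if "norm x = 1" for x
  proof -
    have "H x = P 1 x + P (- 1) x" by (simp add: P_def field_simps)
    then show ?thesis using that by (simp add: c d)
  qed
  then have "\<forall>x. norm x = 1 \<longrightarrow> Complex (f x - Re (c 0)) (- (h x - (- Im (c 0)))) = d 1 * coord1 x + d 0 * coord2 x"
    by (simp add: H_def complex_eq_iff)
  then have "extremal_pair (\<lambda>x. f x - Re (c 0)) (\<lambda>x. h x - (- Im (c 0)))"
    unfolding extremal_pair_iff_complex_linear by blast
  then show ?thesis by blast
qed

text \<open>A real linear function has derivative \<open>Lin (J x)\<close> along \<open>J\<close>; complex linearity then gives both
  the weight and the Cauchy-Riemann equations.\<close>

lemma extremal_pair_derivatives:
  assumes f: "C1_on_sphere f" and h: "C1_on_sphere h" and e: "extremal_pair f h" and x: "norm x = 1"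
  shows "along J1 f x = h x" "along J1 h x = - f x"
    "along J2 f x = - along J3 h x" "along J3 f x = along J2 h x"
proof -
  obtain \<alpha> \<beta> where *: "\<And>x. norm x = 1 \<Longrightarrow> Complex (f x) (- h x) = \<alpha> * coord1 x + \<beta> * coord2 x"
    using e unfolding extremal_pair_iff_complex_linear by blast
  define Lin where "Lin x = \<alpha> * coord1 x + \<beta> * coord2 x" for x
  have Lin: "bounded_linear Lin"
    unfolding Lin_def using coord_linear
    by (intro bounded_linear_add bounded_linear_const_mult) (simp_all add: linear_linear)
  have al: "Complex (along J f x) (- along J h x) = Lin (J x)" if J: "orthogonal_complex_structure J" for J
  proof -
    have "((\<lambda>t. Lin (flow J t x)) has_vector_derivative Lin (J x)) (at 0)"
      using bounded_linear.has_vector_derivative[OF Lin has_vector_derivative_flow[OF J, of x 0]] by simp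
    moreover have "Lin (flow J t x) = Complex (f (flow J t x)) (- h (flow J t x))" for t
      using *[of "flow J t x"] x by (simp add: Lin_def norm_flow[OF J])
    ultimately show ?thesis
      using along_complex(1)[OF J f h x] by (auto intro: vector_derivative_unique_at)
  qed
  have LinJ1: "Lin (J1 y) = \<i> * Lin y" for y by (simp add: Lin_def coord_J1 algebra_simps)
  show "along J1 f x = h x" "along J1 h x = - f x"
    using al[of J1] *[OF x] by (simp_all add: LinJ1 complex_eq_iff) (simp_all add: Lin_def complex_eq_iff)
  have "Complex (along J3 f x) (- along J3 h x) = \<i> * Complex (along J2 f x) (- along J2 h x)"
    using LinJ1[of "J2 x"] by (simp add: al J_products)
  then show "along J2 f x = - along J3 h x" "along J3 f x = along J2 h x"
    by (simp_all add: complex_eq_iff)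
qed

section \<open>The inequality\<close>

lemma Ck_on_cong:
  assumes "Ck_on k U F" "open U" "\<And>x. x \<in> U \<Longrightarrow> F x = G x"
  shows "Ck_on k U G"
  using assms
proof (induction k arbitrary: F G)
  case 0
  then show ?case by (simp cong: continuous_on_cong)
next
  case (Suc k)
  have d: "F differentiable (at x)" if "x \<in> U" for x using Suc.prems that by simp
  have eq: "frechet_derivative F (at x) = frechet_derivative G (at x)" if "x \<in> U" for x
    using frechet_derivative_transform_within_open[OF d Suc.prems(2)] that Suc.prems(3) by blast
  have "G differentiable (at x)" if x: "x \<in> U" for x
  proof -
    obtain D where D: "(F has_derivative D) (at x)" using d[OF x] by (auto simp: differentiable_def)
    have "(G has_derivative D) (at x)"
      by (rule has_derivative_transform_within_open[OF D Suc.prems(2) x]) (rule Suc.prems(3))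
    then show ?thesis by (auto simp: differentiable_def)
  qed
  moreover have "Ck_on k U (\<lambda>x. frechet_derivative G (at x) b)" if "b \<in> Basis" for b
    by (rule Suc.IH[of "\<lambda>x. frechet_derivative F (at x) b"]) (use Suc.prems that eq in auto)
  ultimately show ?case by simp
qed

lemma Ck_on_affine:
  assumes "Ck_on k U F" "open U"
  shows "Ck_on k U (\<lambda>x. a + c * F x)"
  using assms
proof (induction k arbitrary: F a)
  case 0
  then show ?case by (auto intro!: continuous_intros)
next
  case (Suc k)
  have d: "((\<lambda>x. a + c * F x) has_derivative (\<lambda>v. c * frechet_derivative F (at x) v)) (at x)" if "x \<in> U" for x
  proof -
    have "(F has_derivative frechet_derivative F (at x)) (at x)"
      using Suc.prems that by (simp add: frechet_derivative_works[symmetric])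
    then show ?thesis by (auto intro!: derivative_eq_intros)
  qed
  have "Ck_on k U (\<lambda>x. frechet_derivative (\<lambda>x. a + c * F x) (at x) b)" if "b \<in> Basis" for b
  proof (rule Ck_on_cong)
    show "Ck_on k U (\<lambda>x. 0 + c * frechet_derivative F (at x) b)"
      by (rule Suc.IH) (use Suc.prems that in auto)
    show "0 + c * frechet_derivative F (at x) b = frechet_derivative (\<lambda>x. a + c * F x) (at x) b" if "x \<in> U" for x
      using frechet_derivative_at[OF d[OF that], symmetric] by simp
  qed (use Suc.prems in auto)
  then show ?case using d by (auto simp: differentiable_def)
qed

lemma smooth_on_sphere_affine:
  assumes "smooth_on_sphere f"
  shows "smooth_on_sphere (\<lambda>x. a + c * f x)"
  unfolding smooth_on_sphere_def
proof
  fix p :: 'a assume "p \<in> sphere 0 1"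
  then obtain U F where U: "open U" "p \<in> U" "\<forall>k. Ck_on k U F" "\<forall>x\<in>U \<inter> sphere 0 1. F x = f x"
    using assms unfolding smooth_on_sphere_def by metis
  then show "\<exists>U F. open U \<and> p \<in> U \<and> (\<forall>k. Ck_on k U F) \<and> (\<forall>x\<in>U \<inter> sphere 0 1. F x = a + c * f x)"
    by (intro exI[of _ U] exI[of _ "\<lambda>x. a + c * F x"]) (auto intro: Ck_on_affine)
qed

definition kaehler_pairing :: "(real^4 \<Rightarrow> real) \<Rightarrow> (real^4 \<Rightarrow> real) \<Rightarrow> real" where
  "kaehler_pairing f h = (LINT x|sphere_measure. kaehler_form (sphere_grad f x) (sphere_grad h x))"

lemma sphere_grad_affine:
  fixes f :: "real^4 \<Rightarrow> real"
  assumes f: "smooth_on_sphere f" and x: "norm x = 1"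
  shows "sphere_grad (\<lambda>x. a + c * f x) x = c *\<^sub>R sphere_grad f x"
  using f x by (simp add: sphere_grad_frame smooth_on_sphere_imp_C1 smooth_on_sphere_affine along_affine scaleR_add_right)

lemma dirichlet_energy_affine:
  assumes f: "smooth_on_sphere f"
  shows "dirichlet_energy (\<lambda>x. a + c * f x) = c\<^sup>2 * dirichlet_energy f"
proof -
  have "dirichlet_energy (\<lambda>x. a + c * f x) = (LINT x|sphere_measure. c\<^sup>2 * (norm (sphere_grad f x))\<^sup>2)"
    unfolding dirichlet_energy_def
    by (rule Bochner_Integration.integral_cong) (simp_all add: sphere_grad_affine[OF f] power_mult_distrib)
  then show ?thesis by (simp add: dirichlet_energy_def)
qed

lemma kaehler_pairing_affine:
  assumes f: "smooth_on_sphere f" and h: "smooth_on_sphere h"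
  shows "kaehler_pairing (\<lambda>x. a + c * f x) (\<lambda>x. b + d * h x) = c * d * kaehler_pairing f h"
proof -
  have scale: "kaehler_form (c *\<^sub>R u) (d *\<^sub>R v) = c * d * kaehler_form u v" for u v
    by (simp add: kaehler_form_def algebra_simps)
  have "kaehler_pairing (\<lambda>x. a + c * f x) (\<lambda>x. b + d * h x)
      = (LINT x|sphere_measure. c * d * kaehler_form (sphere_grad f x) (sphere_grad h x))"
    unfolding kaehler_pairing_def
    by (rule Bochner_Integration.integral_cong) (simp_all add: sphere_grad_affine f h scale)
  then show ?thesis by (simp add: kaehler_pairing_def)
qed

definition CR_defect :: "(real^4 \<Rightarrow> real) \<Rightarrow> (real^4 \<Rightarrow> real) \<Rightarrow> real^4 \<Rightarrow> real" where
  "CR_defect f h x = (along J2 f x + along J3 h x)\<^sup>2 + (along J3 f x - along J2 h x)\<^sup>2"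

definition fibre_defect :: "(real^4 \<Rightarrow> real) \<Rightarrow> (real^4 \<Rightarrow> real) \<Rightarrow> real^4 \<Rightarrow> real" where
  "fibre_defect f h x = (along J1 f x)\<^sup>2 + (along J1 h x)\<^sup>2 + f x * along J1 h x - h x * along J1 f x"

text \<open>The pairing enters with the factor \<open>3\<close>: two copies are written pointwise and complete the squares of the
  Cauchy-Riemann defect, one copy is replaced by its first-order form and goes to the fibre defect.\<close>

lemma defect_identity:
  assumes f: "smooth_on_sphere f" and h: "smooth_on_sphere h"
  shows "dirichlet_energy f + dirichlet_energy h + 3 * kaehler_pairing f h
    = (LINT x|sphere_measure. fibre_defect f h x) + (LINT x|sphere_measure. CR_defect f h x)"
    and "continuous_on (sphere 0 1) (CR_defect f h)"
proof -
  note C1 = smooth_on_sphere_imp_C1[OF f] smooth_on_sphere_imp_C1[OF h]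
  note frame = energy_and_kaehler_frame(1)[OF C1(1,1)] energy_and_kaehler_frame(1)[OF C1(2,2)] energy_and_kaehler_frame(2)[OF C1]
  note cont = C1[THEN C1_on_sphere_continuous] C1[THEN C1_on_sphere_continuous_along[OF J_structures(1)]]
    C1[THEN C1_on_sphere_continuous_along[OF J_structures(2)]] C1[THEN C1_on_sphere_continuous_along[OF J_structures(3)]]
  note intros = Bochner_Integration.integral_add[symmetric] integrable_sphere_measure continuous_intros cont
  show "continuous_on (sphere 0 1) (CR_defect f h)"
    unfolding CR_defect_def[abs_def] by (intro continuous_intros cont)
  let ?Ef = "\<lambda>x. (along J1 f x)\<^sup>2 + (along J2 f x)\<^sup>2 + (along J3 f x)\<^sup>2"
  let ?Eh = "\<lambda>x. (along J1 h x)\<^sup>2 + (along J2 h x)\<^sup>2 + (along J3 h x)\<^sup>2"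
  let ?K = "\<lambda>x. along J2 f x * along J3 h x - along J3 f x * along J2 h x"
  let ?A = "\<lambda>x. f x * along J1 h x - h x * along J1 f x"
  have "dirichlet_energy f = (LINT x|sphere_measure. ?Ef x)" "dirichlet_energy h = (LINT x|sphere_measure. ?Eh x)"
    unfolding dirichlet_energy_def by (rule Bochner_Integration.integral_cong; simp add: frame)+
  moreover have "kaehler_pairing f h = (LINT x|sphere_measure. ?K x)"
    unfolding kaehler_pairing_def by (rule Bochner_Integration.integral_cong; simp add: frame)
  moreover have "kaehler_pairing f h = (LINT x|sphere_measure. ?A x)"
    unfolding kaehler_pairing_def by (rule kaehler_integral[OF f h])
  ultimately have "dirichlet_energy f + dirichlet_energy h + 3 * kaehler_pairing f h
    = (LINT x|sphere_measure. ?Ef x) + (LINT x|sphere_measure. ?Eh x)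
      + (LINT x|sphere_measure. ?K x) + (LINT x|sphere_measure. ?K x) + (LINT x|sphere_measure. ?A x)" by simp
  also have "\<dots> = (LINT x|sphere_measure. ?Ef x + ?Eh x + ?K x + ?K x + ?A x)"
    by (simp only: Bochner_Integration.integral_add integrable_sphere_measure continuous_on_add continuous_on_diff
        continuous_on_mult continuous_on_power cont)
  also have "\<dots> = (LINT x|sphere_measure. fibre_defect f h x + CR_defect f h x)"
    by (rule Bochner_Integration.integral_cong)
       (simp_all add: fibre_defect_def CR_defect_def power2_eq_square algebra_simps)
  also have "\<dots> = (LINT x|sphere_measure. fibre_defect f h x) + (LINT x|sphere_measure. CR_defect f h x)"
    unfolding fibre_defect_def CR_defect_def
    by (intro Bochner_Integration.integral_add integrable_sphere_measure continuous_intros cont)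
  finally show "dirichlet_energy f + dirichlet_energy h + 3 * kaehler_pairing f h
    = (LINT x|sphere_measure. fibre_defect f h x) + (LINT x|sphere_measure. CR_defect f h x)" .
qed

lemma minus_as_affine: "(\<lambda>x. f x - a) = (\<lambda>x. - a + 1 * f x)" for a :: real
  by auto

lemma energy_sum_inequality:
  assumes f: "smooth_on_sphere f" and h: "smooth_on_sphere h"
  shows "0 \<le> dirichlet_energy f + dirichlet_energy h + 3 * kaehler_pairing f h"
    and "dirichlet_energy f + dirichlet_energy h + 3 * kaehler_pairing f h = 0 \<longleftrightarrow>
      (\<exists>a b. extremal_pair (\<lambda>x. f x - a) (\<lambda>x. h x - b))"
proof -
  note C1 = smooth_on_sphere_imp_C1[OF f] smooth_on_sphere_imp_C1[OF h]
  have fibre: "0 \<le> (LINT x|sphere_measure. fibre_defect f h x)"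
    unfolding fibre_defect_def by (rule hopf_fibre_integral(1)[OF C1])
  have CR: "0 \<le> (LINT x|sphere_measure. CR_defect f h x)"
    by (rule integral_nonneg_AE, rule AE_I2) (simp add: CR_defect_def)
  show "0 \<le> dirichlet_energy f + dirichlet_energy h + 3 * kaehler_pairing f h"
    using fibre CR by (simp add: defect_identity(1)[OF f h])
  show "dirichlet_energy f + dirichlet_energy h + 3 * kaehler_pairing f h = 0 \<longleftrightarrow>
      (\<exists>a b. extremal_pair (\<lambda>x. f x - a) (\<lambda>x. h x - b))"
  proof
    assume "dirichlet_energy f + dirichlet_energy h + 3 * kaehler_pairing f h = 0"
    then have zero: "(LINT x|sphere_measure. fibre_defect f h x) = 0" "(LINT x|sphere_measure. CR_defect f h x) = 0"
      using fibre CR by (simp_all add: defect_identity(1)[OF f h])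
    have "along J2 f x = - along J3 h x \<and> along J3 f x = along J2 h x" if "norm x = 1" for x
    proof -
      have "CR_defect f h x = 0"
        by (rule sphere_integral_nonneg_eq_0[OF defect_identity(2)[OF f h] _ zero(2) that]) (simp add: CR_defect_def)
      then show ?thesis by (simp add: CR_defect_def sum_power2_eq_zero_iff eq_neg_iff_add_eq_0)
    qed
    then show "\<exists>a b. extremal_pair (\<lambda>x. f x - a) (\<lambda>x. h x - b)"
      using hopf_fibre_integral(2)[OF C1] zero(1) unfolding fibre_defect_def
      by (intro CR_function_is_affine[OF C1]) blast+
  next
    assume "\<exists>a b. extremal_pair (\<lambda>x. f x - a) (\<lambda>x. h x - b)"
    then obtain a b where "extremal_pair (\<lambda>x. - a + 1 * f x) (\<lambda>x. - b + 1 * h x)"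
      unfolding minus_as_affine by blast
    moreover define F G where "F = (\<lambda>x. - a + 1 * f x)" and "G = (\<lambda>x. - b + 1 * h x)"
    ultimately have ext: "extremal_pair F G" by metis
    have smooth: "smooth_on_sphere F" "smooth_on_sphere G"
      unfolding F_def G_def by (rule smooth_on_sphere_affine[OF f], rule smooth_on_sphere_affine[OF h])
    note d = extremal_pair_derivatives[OF smooth[THEN smooth_on_sphere_imp_C1] ext]
    have "(LINT x|sphere_measure. fibre_defect F G x) = (LINT (x::real^4)|sphere_measure. 0)"
      by (rule Bochner_Integration.integral_cong) (simp_all add: fibre_defect_def d power2_eq_square)
    moreover have "(LINT x|sphere_measure. CR_defect F G x) = (LINT (x::real^4)|sphere_measure. 0)"
      by (rule Bochner_Integration.integral_cong) (simp_all add: CR_defect_def d)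
    ultimately have "dirichlet_energy F + dirichlet_energy G + 3 * kaehler_pairing F G = 0"
      unfolding defect_identity(1)[OF smooth] by simp
    then show "dirichlet_energy f + dirichlet_energy h + 3 * kaehler_pairing f h = 0"
      unfolding F_def G_def dirichlet_energy_affine[OF f] dirichlet_energy_affine[OF h]
        kaehler_pairing_affine[OF f h] by simp
  qed
qed

lemma dirichlet_energy_nonneg: "0 \<le> dirichlet_energy f"
  unfolding dirichlet_energy_def by (rule integral_nonneg_AE, rule AE_I2) simp

lemma extremal_pair_neg:
  assumes "extremal_pair f h" "norm x = 1"
  shows "f (- x) = - f x" "h (- x) = - h x"
proof -
  obtain \<alpha> \<beta> where *: "\<And>x. norm x = 1 \<Longrightarrow> Complex (f x) (- h x) = \<alpha> * coord1 x + \<beta> * coord2 x"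
    using assms unfolding extremal_pair_iff_complex_linear by blast
  have "Complex (f (- x)) (- h (- x)) = - Complex (f x) (- h x)"
    using assms(2) by (simp add: * linear_neg[OF coord_linear(1)] linear_neg[OF coord_linear(2)])
  then show "f (- x) = - f x" "h (- x) = - h x" by (simp_all add: complex_eq_iff)
qed

lemma sphere_grad_eq_0:
  assumes f: "smooth_on_sphere f" and "dirichlet_energy f = 0" "norm x = 1"
  shows "sphere_grad f x = 0"
proof -
  note C1 = smooth_on_sphere_imp_C1[OF f]
  let ?E = "\<lambda>x. (along J1 f x)\<^sup>2 + (along J2 f x)\<^sup>2 + (along J3 f x)\<^sup>2"
  have "(LINT x|sphere_measure. ?E x) = dirichlet_energy f"
    unfolding dirichlet_energy_def
    by (rule Bochner_Integration.integral_cong) (simp_all add: energy_and_kaehler_frame(1)[OF C1 C1])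
  then have "?E x = 0"
    using assms by (intro sphere_integral_nonneg_eq_0[of ?E])
      (auto intro!: continuous_intros C1_on_sphere_continuous_along C1)
  then have "(norm (sphere_grad f x))\<^sup>2 = 0"
    using assms energy_and_kaehler_frame(1)[OF C1 C1] by metis
  then show ?thesis by simp
qed

lemma kaehler_pairing_eq_0:
  assumes "smooth_on_sphere f" "smooth_on_sphere h" "dirichlet_energy f = 0 \<or> dirichlet_energy h = 0"
  shows "kaehler_pairing f h = 0"
proof -
  have "kaehler_pairing f h = (LINT (x::real^4)|sphere_measure. 0)"
    unfolding kaehler_pairing_def
    by (rule Bochner_Integration.integral_cong)
       (use assms sphere_grad_eq_0[of f] sphere_grad_eq_0[of h] in \<open>auto simp: kaehler_form_def\<close>)
  then show ?thesis by simp
qed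

text \<open>A function of zero energy attains equality in the sum inequality together with the zero function. It is then, up to a constant,
  the real part of a complex linear function with constant imaginary part. That constant is zero by oddness, and
  multiplication by \<open>\<i>\<close> shows that the real part vanishes too.\<close>

lemma dirichlet_energy_eq_0_iff:
  assumes f: "smooth_on_sphere f"
  shows "dirichlet_energy f = 0 \<longleftrightarrow> f constant_on sphere 0 1"
proof
  assume E: "dirichlet_energy f = 0"
  let ?z = "\<lambda>x. 0 + 0 * f x"
  have z: "smooth_on_sphere ?z" by (rule smooth_on_sphere_affine[OF f])
  have "dirichlet_energy f + dirichlet_energy ?z + 3 * kaehler_pairing f ?z = 0"
    using kaehler_pairing_eq_0[OF f z] E unfolding dirichlet_energy_affine[OF f] by simp
  then obtain a b where ext: "extremal_pair (\<lambda>x. f x - a) (\<lambda>x. - b)"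
    unfolding energy_sum_inequality(2)[OF f z] by auto
  obtain \<alpha> \<beta> where *: "\<And>x. norm x = 1 \<Longrightarrow> Complex (f x - a) b = \<alpha> * coord1 x + \<beta> * coord2 x"
    using ext unfolding extremal_pair_iff_complex_linear by auto
  have "f x = a" if x: "norm x = 1" for x
  proof -
    have b: "b = 0" using extremal_pair_neg(2)[OF ext x] by simp
    have "Complex (f (J1 x) - a) b = \<i> * Complex (f x - a) b"
      using * x orthogonal_complex_structureD(2)[OF J_structures(1), of x]
      by (simp add: coord_J1 algebra_simps)
    then show ?thesis using b by (simp add: complex_eq_iff)
  qed
  then show "f constant_on sphere 0 1" by (auto simp: constant_on_def)
next
  assume "f constant_on sphere 0 1"
  then obtain c where c: "\<And>x. norm x = 1 \<Longrightarrow> f x = c" by (auto simp: constant_on_def)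
  have "along J f x = 0" if "orthogonal_complex_structure J" "norm x = 1" for J x
    using that c by (simp add: along_def norm_flow)
  then have "dirichlet_energy f = (LINT (x::real^4)|sphere_measure. 0)"
    unfolding dirichlet_energy_def using smooth_on_sphere_imp_C1[OF f]
    by (intro Bochner_Integration.integral_cong) (auto simp: energy_and_kaehler_frame(1))
  then show "dirichlet_energy f = 0" by simp
qed

text \<open>With \<open>K\<close> the pairing and \<open>E\<close> the energy, the sum inequality for \<open>f\<close> and \<open>c h\<close>, divided by \<open>c > 0\<close>,
  reads \<open>- 3 K \<le> E f / c + c E h\<close>; the right-hand side is smallest for \<open>c = sqrt (E f / E h)\<close>, where it is
  \<open>2 sqrt (E f) sqrt (E h)\<close>. A constant function makes both sides vanish.\<close>

lemma cauchy_riemann_inequality: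
  assumes f: "smooth_on_sphere f" and h: "smooth_on_sphere h"
  shows "- kaehler_pairing f h \<le> 2/3 * sqrt (dirichlet_energy f) * sqrt (dirichlet_energy h)"
    and "- kaehler_pairing f h = 2/3 * sqrt (dirichlet_energy f) * sqrt (dirichlet_energy h) \<longleftrightarrow>
      f constant_on sphere 0 1 \<or> h constant_on sphere 0 1 \<or>
      (\<exists>a b c. c > 0 \<and> extremal_pair (\<lambda>x. f x - a) (\<lambda>x. c * (h x - b)))"
proof -
  define E where "E = dirichlet_energy f"
  define F where "F = dirichlet_energy h"
  define K where "K = kaehler_pairing f h"
  have nonneg: "E \<ge> 0" "F \<ge> 0" by (simp_all add: E_def F_def dirichlet_energy_nonneg)
  have scaled: "0 \<le> E + c\<^sup>2 * F + 3 * c * K"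
    "E + c\<^sup>2 * F + 3 * c * K = 0 \<longleftrightarrow> (\<exists>a b. extremal_pair (\<lambda>x. f x - a) (\<lambda>x. c * h x - b))" for c
  proof -
    note * = energy_sum_inequality[OF f smooth_on_sphere_affine[OF h, of 0 c]]
    have "dirichlet_energy (\<lambda>x. 0 + c * h x) = c\<^sup>2 * F" by (simp only: dirichlet_energy_affine[OF h] F_def)
    moreover have "kaehler_pairing f (\<lambda>x. 0 + c * h x) = c * K"
      using kaehler_pairing_affine[OF f h, of 0 1 0 c] by (simp add: K_def)
    ultimately show "0 \<le> E + c\<^sup>2 * F + 3 * c * K"
      "E + c\<^sup>2 * F + 3 * c * K = 0 \<longleftrightarrow> (\<exists>a b. extremal_pair (\<lambda>x. f x - a) (\<lambda>x. c * h x - b))"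
      using * by (simp_all add: E_def mult.assoc)
  qed
  have optimal: "E + c\<^sup>2 * F + 3 * c * K = 3 * c * (2/3 * sqrt E * sqrt F - - K)"
    if "c = sqrt E / sqrt F" "F > 0" for c
  proof -
    have "c * sqrt F = sqrt E" using that by simp
    then have "E = (c * sqrt F)\<^sup>2" using nonneg by simp
    then have E: "E = c\<^sup>2 * F" using nonneg by (simp add: power_mult_distrib)
    have "3 * c * (2/3 * sqrt E * sqrt F) = 2 * (c * sqrt F) * sqrt E" by simp
    also have "\<dots> = 2 * E" using \<open>c * sqrt F = sqrt E\<close> nonneg by simp
    finally show ?thesis using E by (simp add: algebra_simps)
  qed
  have degenerate: "K = 0" if "E = 0 \<or> F = 0"
    using kaehler_pairing_eq_0[OF f h] that by (simp add: E_def F_def K_def)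
  show ineq: "- kaehler_pairing f h \<le> 2/3 * sqrt (dirichlet_energy f) * sqrt (dirichlet_energy h)"
  proof (cases "E = 0 \<or> F = 0")
    case True
    then show ?thesis using degenerate nonneg by (simp flip: E_def F_def K_def)
  next
    case False
    then have "E > 0" "F > 0" using nonneg by auto
    then show ?thesis
      using scaled(1)[of "sqrt E / sqrt F"] unfolding optimal[OF refl \<open>F > 0\<close>]
      by (simp add: zero_le_mult_iff zero_le_divide_iff flip: E_def F_def K_def)
  qed
  show "- kaehler_pairing f h = 2/3 * sqrt (dirichlet_energy f) * sqrt (dirichlet_energy h) \<longleftrightarrow>
      f constant_on sphere 0 1 \<or> h constant_on sphere 0 1 \<or>
      (\<exists>a b c. c > 0 \<and> extremal_pair (\<lambda>x. f x - a) (\<lambda>x. c * (h x - b)))"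
    unfolding dirichlet_energy_eq_0_iff[OF f, symmetric] dirichlet_energy_eq_0_iff[OF h, symmetric]
    unfolding E_def[symmetric] F_def[symmetric] K_def[symmetric]
  proof
    assume eq: "- K = 2/3 * sqrt E * sqrt F"
    show "E = 0 \<or> F = 0 \<or> (\<exists>a b c. c > 0 \<and> extremal_pair (\<lambda>x. f x - a) (\<lambda>x. c * (h x - b)))"
    proof (cases "E = 0 \<or> F = 0")
      case False
      define c where "c = sqrt E / sqrt F"
      have c: "c > 0" "F > 0" using False nonneg by (auto simp: c_def)
      have "E + c\<^sup>2 * F + 3 * c * K = 0"
        unfolding optimal[OF c_def c(2)] eq by simp
      then obtain a b where "extremal_pair (\<lambda>x. f x - a) (\<lambda>x. c * h x - b)"
        unfolding scaled(2) by blast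
      moreover have "(\<lambda>x. c * h x - b) = (\<lambda>x. c * (h x - b / c))"
        using c(1) by (auto simp: algebra_simps)
      ultimately show ?thesis using c(1) by metis
    qed auto
  next
    assume "E = 0 \<or> F = 0 \<or> (\<exists>a b c. c > 0 \<and> extremal_pair (\<lambda>x. f x - a) (\<lambda>x. c * (h x - b)))"
    then consider "E = 0 \<or> F = 0" | a b c where "c > 0" "extremal_pair (\<lambda>x. f x - a) (\<lambda>x. c * (h x - b))"
      by blast
    then show "- K = 2/3 * sqrt E * sqrt F"
    proof cases
      case 1
      then show ?thesis using degenerate by auto
    next
      case 2
      have "(\<lambda>x. c * (h x - b)) = (\<lambda>x. c * h x - c * b)" by (auto simp: algebra_simps)
      with 2 have "E + c\<^sup>2 * F + 3 * c * K = 0" unfolding scaled(2) by metis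
      moreover have "0 \<le> (sqrt E - c * sqrt F)\<^sup>2" by simp
      then have "2 * c * (sqrt E * sqrt F) \<le> E + c\<^sup>2 * F"
        using nonneg by (simp add: power2_diff power_mult_distrib mult_ac)
      ultimately have "c * (2 * (sqrt E * sqrt F)) \<le> c * (- 3 * K)" by (simp add: algebra_simps)
      then have "2 * (sqrt E * sqrt F) \<le> - 3 * K" using 2(1) by (rule mult_left_le_imp_le)
      then show ?thesis using ineq by (simp flip: E_def F_def K_def)
    qed
  qed
qed

text \<open>An odd function has mean zero, so the shift is the mean of \<open>f\<close>.\<close>

lemma mean_zero_shift:
  fixes f :: "real^4 \<Rightarrow> real"
  assumes f: "smooth_on_sphere f" and mean: "(LINT x|sphere_measure. f x) = 0"
    and odd: "\<And>x. norm x = 1 \<Longrightarrow> f (- x) - a = - (f x - a)"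
  shows "a = 0"
proof -
  have cont: "continuous_on (sphere 0 1) f"
    by (rule C1_on_sphere_continuous[OF smooth_on_sphere_imp_C1[OF f]])
  have neg: "orthogonal_transformation (uminus :: real^4 \<Rightarrow> real^4)"
    by (simp add: orthogonal_transformation_def linear_uminus)
  have cont': "continuous_on (sphere 0 1) (\<lambda>x. f (- x))"
    by (rule continuous_on_compose2[OF cont]) (auto intro!: continuous_intros)
  have "(LINT (x::real^4)|sphere_measure. 2 * a) = (LINT x|sphere_measure. f x + f (- x))"
    by (rule Bochner_Integration.integral_cong) (use odd in \<open>auto simp: algebra_simps\<close>)
  also have "\<dots> = (LINT x|sphere_measure. f x) + (LINT x|sphere_measure. f (- x))"
    by (intro Bochner_Integration.integral_add integrable_sphere_measure cont cont')
  also have "\<dots> = 0" using sphere_integral_orthogonal[OF neg cont] mean by simp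
  finally have "(LINT (x::real^4)|sphere_measure. a\<^sup>2) = 0" by (auto simp: power2_eq_square)
  moreover have "norm (axis 1 1 :: real^4) = 1" by simp
  ultimately have "a\<^sup>2 = 0"
    using sphere_integral_nonneg_eq_0[of "\<lambda>_ :: real^4. a\<^sup>2" "axis 1 1"] by simp
  then show ?thesis by simp
qed

theorem corollary1p1:
  fixes f h :: "real^4 \<Rightarrow> real"
  assumes "smooth_on_sphere f" and "smooth_on_sphere h"
  defines "L \<equiv> - (LINT x|sphere_measure. kaehler_form (sphere_grad f x) (sphere_grad h x))"
    and "R \<equiv> 2/3 * sqrt (dirichlet_energy f) * sqrt (dirichlet_energy h)"
  shows "L \<le> R
    \<and> (extremal_pair f h \<longrightarrow> L = R)
    \<and> (normalised_pair f h \<longrightarrow> (L = R \<longleftrightarrow> extremal_pair f h))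
    \<and> (L = R \<longleftrightarrow>
         f constant_on sphere 0 1 \<or> h constant_on sphere 0 1 \<or>
         (\<exists>a b c. c > 0 \<and> extremal_pair (\<lambda>x. f x - a) (\<lambda>x. c * (h x - b))))"
proof (intro conjI)
  note f = assms(1) and h = assms(2)
  have L: "L = - kaehler_pairing f h" by (simp add: L_def kaehler_pairing_def)
  show "L \<le> R" unfolding L R_def by (rule cauchy_riemann_inequality(1)[OF f h])
  show iff: "L = R \<longleftrightarrow>
         f constant_on sphere 0 1 \<or> h constant_on sphere 0 1 \<or>
         (\<exists>a b c. c > 0 \<and> extremal_pair (\<lambda>x. f x - a) (\<lambda>x. c * (h x - b)))"
    unfolding L R_def by (rule cauchy_riemann_inequality(2)[OF f h])
  have ext: "L = R" if "extremal_pair f h"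
  proof -
    have "0 < (1::real) \<and> extremal_pair (\<lambda>x. f x - 0) (\<lambda>x. 1 * (h x - 0))" using that by simp
    then show ?thesis unfolding iff by blast
  qed
  then show "extremal_pair f h \<longrightarrow> L = R" ..
  have "extremal_pair f h" if n: "normalised_pair f h" and eq: "L = R"
  proof -
    have "R = 2/3 * dirichlet_energy f"
      using n dirichlet_energy_nonneg[of h] by (simp add: R_def normalised_pair_def)
    then have "dirichlet_energy f + dirichlet_energy h + 3 * kaehler_pairing f h = 0"
      using n eq by (simp add: L normalised_pair_def)
    then obtain a b where ab: "extremal_pair (\<lambda>x. f x - a) (\<lambda>x. h x - b)"
      unfolding energy_sum_inequality(2)[OF f h] by blast
    have "a = 0"
      by (rule mean_zero_shift[OF f]) (use n extremal_pair_neg(1)[OF ab] in \<open>auto simp: normalised_pair_def\<close>)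
    moreover have "b = 0"
      by (rule mean_zero_shift[OF h]) (use n extremal_pair_neg(2)[OF ab] in \<open>auto simp: normalised_pair_def\<close>)
    ultimately show ?thesis using ab by simp
  qed
  then show "normalised_pair f h \<longrightarrow> (L = R \<longleftrightarrow> extremal_pair f h)" using ext by blast
qed

end
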